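(* For every dimension $d\ge 2$ there exists a set of $\frac{d(d+3)}{2}$ tiles (which may be rotated when placed) that can tile any polyomino in dimension $d$ other than the unit cube. Moreover, there exists a linear-time algorithm (in the size of the polyomino) that finds a tiling of the polyomino with these tiles.
   Context: A polyomino in dimension $d$ is a finite region that is a union of unit $d$-dimensional cubes of the grid $\mathbb{Z}^d$ and is connected (through cubes sharing a $(d-1)$-dimensional face); it need not be simply connected. Its size is the number of unit cubes it contains. A tile is a simply connected polyomino; a copy of a tile is the image of the tile under a rotation preserving the grid followed by a translation by an integer vector, and tiles differing by a rotation are regarded as the same tile. A set of tiles $S$ tiles a polyomino $R$ if $R$ can be entirely covered, without overlap and without leaving $R$, by any number of copies of tiles of $S$; such a covering is a tiling of $R$ by $S$. All tiles of the set are polyominoes different from the unit cube. *)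

theory Defs
  imports "HOL-Analysis.Analysis"
begin

section \<open>Polyominoes, tiles and tilings\<close>

text \<open>
  A unit cube of the grid is represented by an integer point, thought of as the centre of the cube
  (that is, the grid is shifted by one half in each direction). With this convention an integer
  rotation matrix maps the cube with centre \<open>c\<close> onto the cube with centre \<open>Q *v c\<close>.
\<close>

definition cube :: "int ^ 'n::finite \<Rightarrow> (real ^ 'n) set" where
  "cube c = {x. \<forall>i. \<bar>x $ i - of_int (c $ i)\<bar> \<le> 1 / 2}"

definition region :: "(int ^ 'n::finite) set \<Rightarrow> (real ^ 'n) set" where
  "region P = (\<Union>c\<in>P. cube c)"

definition face_adjacent :: "int ^ 'n::finite \<Rightarrow> int ^ 'n \<Rightarrow> bool" where
  "face_adjacent a b \<longleftrightarrow> (\<exists>i. b = a + axis i 1 \<or> b = a - axis i 1)"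

definition polyomino :: "(int ^ 'n::finite) set \<Rightarrow> bool" where
  "polyomino P \<longleftrightarrow> finite P \<and> P \<noteq> {} \<and>
     (\<forall>a\<in>P. \<forall>b\<in>P. (\<lambda>x y. x \<in> P \<and> y \<in> P \<and> face_adjacent x y)\<^sup>*\<^sup>* a b)"

definition tile :: "(int ^ 'n::finite) set \<Rightarrow> bool" where
  "tile T \<longleftrightarrow> polyomino T \<and> simply_connected (region T)"

definition place :: "int ^ 'n ^ 'n::finite \<Rightarrow> int ^ 'n \<Rightarrow> (int ^ 'n) set \<Rightarrow> (int ^ 'n) set" where
  "place Q v T = (\<lambda>c. Q *v c + v) ` T"

text \<open>
  The rotations preserving the grid are the rotation matrices with integer entries, i.e. the signed
  permutation matrices of determinant 1.
\<close>

definition is_copy :: "(int ^ 'n::finite) set \<Rightarrow> (int ^ 'n) set \<Rightarrow> bool" where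
  "is_copy T P \<longleftrightarrow> (\<exists>Q v. rotation_matrix Q \<and> P = place Q v T)"

definition is_tiling :: "(int ^ 'n::finite) set set \<Rightarrow> (int ^ 'n) set \<Rightarrow> (int ^ 'n) set set \<Rightarrow> bool" where
  "is_tiling S R C \<longleftrightarrow> partition_on R C \<and> (\<forall>P\<in>C. \<exists>T\<in>S. is_copy T P)"

definition tiles_polyomino :: "(int ^ 'n::finite) set set \<Rightarrow> (int ^ 'n) set \<Rightarrow> bool" where
  "tiles_polyomino S R \<longleftrightarrow> (\<exists>C. is_tiling S R C)"

text \<open>
  Tiles differing by a rotation (or a translation) are the same tile, so a set of tiles must not
  contain two different copies of one tile; otherwise its cardinality would not be the number of
  tiles.
\<close>

definition tile_set :: "(int ^ 'n::finite) set set \<Rightarrow> bool" where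
  "tile_set S \<longleftrightarrow> (\<forall>T\<in>S. tile T \<and> \<not> is_singleton T) \<and> pairwise (\<lambda>T T'. \<not> is_copy T T') S"


section \<open>Random access machines\<close>

text \<open>
  The model of computation is the random access machine with the uniform cost criterion, with
  addition and subtraction as the only arithmetic operations and with structured control flow. The
  state consists of registers, which are addressed directly, and of a memory, which is addressed
  indirectly through registers. Every instruction and every test takes one unit of time.
\<close>

type_synonym reg = nat

type_synonym ram_state = "(reg \<Rightarrow> int) \<times> (int \<Rightarrow> int)"

datatype ram_prog =
    Const reg int
  | Add reg reg reg
  | Sub reg reg reg
  | Load reg reg  \<comment> \<open>\<open>Load r a\<close>: read the memory cell whose address is in \<open>a\<close> into \<open>r\<close>\<close>
  | Store reg reg  \<comment> \<open>\<open>Store a r\<close>: write \<open>r\<close> to the memory cell whose address is in \<open>a\<close>\<close>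
  | Seq ram_prog ram_prog
  | IfPos reg ram_prog ram_prog
  | WhilePos reg ram_prog

inductive exec :: "ram_prog \<Rightarrow> ram_state \<Rightarrow> nat \<Rightarrow> ram_state \<Rightarrow> bool" where
  Const: "exec (Const r k) (\<rho>, \<mu>) 1 (\<rho>(r := k), \<mu>)"
| Add: "exec (Add r a b) (\<rho>, \<mu>) 1 (\<rho>(r := \<rho> a + \<rho> b), \<mu>)"
| Sub: "exec (Sub r a b) (\<rho>, \<mu>) 1 (\<rho>(r := \<rho> a - \<rho> b), \<mu>)"
| Load: "exec (Load r a) (\<rho>, \<mu>) 1 (\<rho>(r := \<mu> (\<rho> a)), \<mu>)"
| Store: "exec (Store a r) (\<rho>, \<mu>) 1 (\<rho>, \<mu>(\<rho> a := \<rho> r))"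
| Seq: "exec p s t s' \<Longrightarrow> exec q s' t' s'' \<Longrightarrow> exec (Seq p q) s (t + t') s''"
| IfTrue: "fst s r > 0 \<Longrightarrow> exec p s t s' \<Longrightarrow> exec (IfPos r p q) s (t + 1) s'"
| IfFalse: "\<not> fst s r > 0 \<Longrightarrow> exec q s t s' \<Longrightarrow> exec (IfPos r p q) s (t + 1) s'"
| WhileFalse: "\<not> fst s r > 0 \<Longrightarrow> exec (WhilePos r p) s 1 s"
| WhileTrue: "fst s r > 0 \<Longrightarrow> exec p s t s' \<Longrightarrow> exec (WhilePos r p) s' t' s'' \<Longrightarrow>
    exec (WhilePos r p) s (t + t' + 1) s''"

inductive_cases exec_elims:
  "exec (Const r k) s t s'"
  "exec (Add r a b) s t s'"
  "exec (Sub r a b) s t s'"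
  "exec (Load r a) s t s'"
  "exec (Store a r) s t s'"
  "exec (Seq p q) s t s'"
  "exec (IfPos r p q) s t s'"
  "exec (WhilePos r p) s t s'"

lemma exec_deterministic:
  "exec p s t s' \<Longrightarrow> exec p s u s'' \<Longrightarrow> u = t \<and> s'' = s'"
proof (induction arbitrary: u s'' rule: exec.induct)
  case (Seq p s t s' q t' s2)
  from Seq.prems show ?case
    by (rule exec_elims(6)) (metis Seq.IH)
next
  case (IfTrue s r p t s' q)
  from IfTrue.prems show ?case
    by (rule exec_elims(7)) (use IfTrue.hyps(1) IfTrue.IH in auto)
next
  case (IfFalse s r q t s' p)
  from IfFalse.prems show ?case
    by (rule exec_elims(7)) (use IfFalse.hyps(1) IfFalse.IH in auto)
next
  case (WhileFalse s r p)
  from WhileFalse.prems show ?case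
    by (rule exec_elims(8)) (use WhileFalse.hyps(1) in auto)
next
  case (WhileTrue s r p t s' t' s2)
  from WhileTrue.prems show ?case
    by (rule exec_elims(8)) (use WhileTrue.hyps(1) in simp, metis WhileTrue.IH Suc_eq_plus1)
qed (auto elim!: exec_elims(1-5))


section \<open>Algorithms for tiling polyominoes\<close>

text \<open>
  The input is the list of the cubes of the polyomino, in any order and without repetition: the
  number of cubes is in register 0, and coordinate \<open>j\<close> of cube \<open>i\<close> is in memory cell \<open>i * d + j\<close>,
  where \<open>d\<close> is the dimension. Everything else is 0. The coordinates, which are indexed by the finite
  type \<open>'n\<close>, are numbered from 0 to \<open>d - 1\<close> by the library bijection \<open>to_nat_on UNIV\<close> and its
  inverse \<open>from_nat_into UNIV\<close>.
\<close>

definition input_state :: "(int ^ 'n::finite) list \<Rightarrow> ram_state" where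
  "input_state xs =
    (\<lambda>r. if r = 0 then int (length xs) else 0,
     \<lambda>a. if 0 \<le> a \<and> a < int (length xs * CARD('n))
         then (xs ! (nat a div CARD('n))) $ from_nat_into UNIV (nat a mod CARD('n)) else 0)"

text \<open>
  The output is a list of placed tiles. Its length is in register 0 and its start address is in
  register 1. A placed tile takes \<open>1 + d * d + d\<close> consecutive memory cells: the number of the tile,
  the rotation matrix in row-major order, and the translation vector.
\<close>

type_synonym 'n placement = "int \<times> (int ^ 'n ^ 'n) \<times> (int ^ 'n)"

definition read_placement :: "(int \<Rightarrow> int) \<Rightarrow> int \<Rightarrow> ('n::finite) placement" where
  "read_placement \<mu> b =
    (\<mu> b,
     \<chi> i j. \<mu> (b + 1 + int (to_nat_on (UNIV :: 'n set) i * CARD('n) + to_nat_on (UNIV :: 'n set) j)),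
     \<chi> i. \<mu> (b + 1 + int (CARD('n) * CARD('n) + to_nat_on (UNIV :: 'n set) i)))"

definition output_placements :: "ram_state \<Rightarrow> ('n::finite) placement list" where
  "output_placements s =
    map (\<lambda>k. read_placement (snd s) (fst s 1 + int (k * (1 + CARD('n) * CARD('n) + CARD('n)))))
      [0..<nat (fst s 0)]"

definition valid_placement :: "(int ^ 'n::finite) set list \<Rightarrow> 'n placement \<Rightarrow> bool" where
  "valid_placement ts = (\<lambda>(k, Q, v). 0 \<le> k \<and> k < int (length ts) \<and> rotation_matrix Q)"

definition placed_tile :: "(int ^ 'n::finite) set list \<Rightarrow> 'n placement \<Rightarrow> (int ^ 'n) set" where
  "placed_tile ts = (\<lambda>(k, Q, v). place Q v (ts ! nat k))"

definition describes_tiling ::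
    "(int ^ 'n::finite) set list \<Rightarrow> (int ^ 'n) set \<Rightarrow> 'n placement list \<Rightarrow> bool" where
  "describes_tiling ts R ps \<longleftrightarrow>
     (\<forall>p\<in>set ps. valid_placement ts p) \<and>
     distinct (map (placed_tile ts) ps) \<and>
     is_tiling (set ts) R (placed_tile ts ` set ps)"

text \<open>
  The list \<open>ts\<close> numbers the tiles of \<open>S\<close>. The constant \<open>C\<close> and the program may depend on the tiles
  (in particular on the dimension), but not on the polyomino.
\<close>

definition linear_time_tiling_algorithm :: "(int ^ 'n::finite) set set \<Rightarrow> ram_prog \<Rightarrow> bool" where
  "linear_time_tiling_algorithm S prog \<longleftrightarrow>
    (\<exists>ts C. distinct ts \<and> set ts = S \<and>
      (\<forall>R xs. polyomino R \<longrightarrow> \<not> is_singleton R \<longrightarrow> distinct xs \<longrightarrow> set xs = R \<longrightarrow>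
        (\<exists>t s. exec prog (input_state xs) t s \<and> t \<le> C * card R \<and>
               describes_tiling ts R (output_placements s))))"

end

theory Submission
  imports Defs
begin

text \<open>
  The tiles are the stars: a central cube together with a nonempty set of its neighbours. Up to
  rotation, a star is determined by the number \<open>a\<close> of axes on which it has both neighbours and the
  number \<open>b\<close> of axes on which it has one, where \<open>1 \<le> a + b \<le> d\<close>; this gives \<open>d (d + 3) / 2\<close> tiles.

  The adjacency graph of a polyomino with at least two cubes has no isolated vertices. Delete its
  edges one after another, whenever both endpoints still have degree at least 2. Every remaining edge
  has an endpoint of degree 1 and no vertex has become isolated, so the components are stars.

  To do this in linear time without sorting, the cubes are stored at addresses that are mixed radix
  numbers formed from their coordinates. A polyomino with \<open>n\<close> cubes has extent at most \<open>n\<close> in every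
  direction, so the radix \<open>2 n + 1\<close> suffices; the multiples of the powers of the radix that are
  needed are tabulated by repeated addition, and neighbours are found by adding constants.
\<close>

section \<open>Star-shaped tiles\<close>

text \<open>Up to isometry the classification is immediate, since axes may be permuted and reflected
  at will. Only rotations are allowed, though, and a shape can differ from its mirror image. Stars
  cannot: if some axis carries two arms or none, the reflection in that axis is a symmetry;
  otherwise every axis carries one arm, and exchanging two axes is a symmetry of the canonical star.
  An isometry of determinant -1 is corrected by such a symmetry. The exchange is where d \<ge> 2
  enters. The machine does not compute rotations. For fixed d there are only 2^(2d) sets of arms, so
  a rotation for each is chosen in advance and enters the program as constants, selected by a
  decision tree. The work per cube is then loop-free, and loops run only over cubes and table
  entries. The addresses spread over a range of order n^d, far more than could be initialised in
  linear time. This is harmless: only cells that are touched cost time, and all negative cells are 0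
  in the input state, which already represents the empty graph.\<close>

definition dvec :: "'n::finite \<times> bool \<Rightarrow> int ^ 'n" where
  "dvec = (\<lambda>(i, s). axis i (if s then 1 else - 1))"

definition star :: "('n::finite \<times> bool) set \<Rightarrow> (int ^ 'n) set" where
  "star A = insert 0 (dvec ` A)"

lemma dvec_component: "dvec (i, s) $ j = (if j = i then if s then 1 else - 1 else 0)"
  by (auto simp: dvec_def axis_def)

lemma dvec_nonzero [simp]: "dvec p \<noteq> 0"
  by (cases p) (auto simp: vec_eq_iff dvec_component)

lemma inj_dvec: "inj dvec"
proof (rule injI)
  fix p q :: "'a \<times> bool"
  assume eq: "dvec p = dvec q"
  obtain i s where p: "p = (i, s)" by fastforce
  obtain j t where q: "q = (j, t)" by fastforce
  have "dvec (i, s) $ i = dvec (j, t) $ i"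
    using eq p q by simp
  then show "p = q"
    using p q by (auto simp: dvec_component split: if_splits)
qed

lemma uminus_dvec: "- dvec (i, s) = dvec (i, \<not> s)"
  by (auto simp: vec_eq_iff dvec_component)

lemma card_star: "card (star A) = Suc (card A)"
proof -
  have "0 \<notin> dvec ` A"
    using dvec_nonzero by (metis imageE)
  then show ?thesis
    by (simp add: star_def card_image inj_on_subset[OF inj_dvec])
qed

lemma face_adjacent_iff: "face_adjacent a b \<longleftrightarrow> (\<exists>p. b = a + dvec p)"
proof
  assume "face_adjacent a b"
  then obtain i where "b = a + axis i 1 \<or> b = a - axis i 1"
    unfolding face_adjacent_def by blast
  then have "b = a + dvec (i, True) \<or> b = a + dvec (i, False)"
    by (auto simp: vec_eq_iff dvec_component axis_def)
  then show "\<exists>p. b = a + dvec p"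
    by blast
next
  assume "\<exists>p. b = a + dvec p"
  then obtain i s where "b = a + dvec (i, s)"
    by auto
  then have "b = a + axis i 1 \<or> b = a - axis i 1"
    by (cases s) (auto simp: vec_eq_iff dvec_component axis_def)
  then show "face_adjacent a b"
    unfolding face_adjacent_def by blast
qed

lemma polyomino_star: "polyomino (star A)"
proof -
  define E where "E = (\<lambda>x y. x \<in> star A \<and> y \<in> star A \<and> face_adjacent x y)"
  have out: "E\<^sup>*\<^sup>* 0 a" if "a \<in> star A" for a
  proof (cases "a = 0")
    case False
    then have "E 0 a"
      using that by (auto simp: star_def E_def face_adjacent_iff)
    then show ?thesis by blast
  qed simp
  have inward: "E\<^sup>*\<^sup>* a 0" if a: "a \<in> star A" for a
  proof (cases "a = 0")
    case False
    then obtain i s where p: "(i, s) \<in> A" "a = dvec (i, s)"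
      using a by (auto simp: star_def)
    have "(0 :: int ^ 'a) = a + dvec (i, \<not> s)"
      using p by (simp flip: uminus_dvec)
    then have "E a 0"
      using a unfolding E_def face_adjacent_iff by (auto simp: star_def)
    then show ?thesis by blast
  qed simp
  show ?thesis
    unfolding polyomino_def E_def[symmetric]
    using out inward by (auto simp: star_def intro: rtranclp_trans)
qed

text \<open>Moving a point towards the origin shrinks its coordinates without changing their signs.
  In an arm along axis \<open>i\<close> the other coordinates stay within 1/2, and coordinate
  \<open>i\<close> is either within 1/2, which gives the central cube, or still in the range of that
  arm. Starlikeness yields simple connectedness in every dimension.\<close>

lemma starlike_region_star: "starlike (region (star A))"
  unfolding starlike_def
proof (intro bexI ballI subsetI)
  show "0 \<in> region (star A)"
    by (auto simp: region_def star_def cube_def)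
next
  fix x y :: "real ^ 'a"
  assume "x \<in> region (star A)" and "y \<in> closed_segment 0 x"
  then obtain c u where c: "c \<in> star A" "x \<in> cube c" and u: "0 \<le> u" "u \<le> 1" "y = u *\<^sub>R x"
    by (auto simp: region_def closed_segment_def)
  have le: "\<bar>y $ i\<bar> \<le> \<bar>x $ i\<bar>" for i
    using u by (simp add: abs_mult mult_left_le_one_le)
  show "y \<in> region (star A)"
  proof (cases "c = 0")
    case True
    then have "y \<in> cube 0"
      using c(2) order_trans[OF le, of _ "1 / 2"] unfolding cube_def by simp
    then show ?thesis
      by (auto simp: region_def star_def)
  next
    case False
    then obtain i s where p: "(i, s) \<in> A" "c = dvec (i, s)"
      using c by (auto simp: star_def)
    have x: "\<bar>x $ j - real_of_int (dvec (i, s) $ j)\<bar> \<le> 1 / 2" for j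
      using c(2) p by (auto simp: cube_def)
    have other: "\<bar>y $ j\<bar> \<le> 1 / 2" if "j \<noteq> i" for j
      using x[of j] le[of j] that by (auto simp: dvec_component)
    show ?thesis
    proof (cases "\<bar>y $ i\<bar> \<le> 1 / 2")
      case True
      then have "y \<in> cube 0"
        using other by (force simp: cube_def)
      then show ?thesis
        by (auto simp: region_def star_def)
    next
      case False
      have "\<bar>y $ j - real_of_int (dvec (i, s) $ j)\<bar> \<le> 1 / 2" for j
      proof (cases "j = i")
        case True
        have yi: "y $ i = u * x $ i"
          using u by simp
        show ?thesis
        proof (cases s)
          case True
          then have "1 / 2 \<le> x $ i" "x $ i \<le> 3 / 2"
            using x[of i] unfolding abs_le_iff by (auto simp: dvec_component)
          moreover from this have "0 \<le> y $ i"
            using u yi by simp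
          ultimately have "\<bar>y $ i - 1\<bar> \<le> 1 / 2"
            using False le[of i] by linarith
          then show ?thesis
            using \<open>j = i\<close> True by (simp add: dvec_component)
        next
          case s: False
          then have "x $ i \<le> - 1 / 2" "- 3 / 2 \<le> x $ i"
            using x[of i] unfolding abs_le_iff by (auto simp: dvec_component)
          moreover from this have "y $ i \<le> 0"
            using u yi by (simp add: mult_nonneg_nonpos)
          ultimately have "\<bar>y $ i - (- 1)\<bar> \<le> 1 / 2"
            using False le[of i] by linarith
          then show ?thesis
            using \<open>j = i\<close> s by (simp add: dvec_component)
        qed
      qed (use other in \<open>auto simp: dvec_component\<close>)
      then have "y \<in> cube (dvec (i, s))"
        by (simp add: cube_def)
      then show ?thesis
        using p by (auto simp: region_def star_def)
    qed
  qed
qed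

lemma tile_star: "tile (star A)"
  by (simp add: tile_def polyomino_star starlike_imp_simply_connected starlike_region_star)

lemma not_singleton_star:
  assumes "A \<noteq> {}"
  shows "\<not> is_singleton (star A)"
proof -
  have "card A \<noteq> 0"
    using assms by simp
  then show ?thesis
    by (simp add: is_singleton_altdef card_star)
qed


section \<open>Signed permutation matrices\<close>

definition spm :: "('n \<Rightarrow> 'n) \<Rightarrow> ('n \<Rightarrow> int) \<Rightarrow> int ^ 'n ^ 'n::finite" where
  "spm \<sigma> \<epsilon> = (\<chi> r c. if r = \<sigma> c then \<epsilon> c else 0)"

text \<open>With signs coded as booleans, equality is multiplication of signs:
  \<open>s = (\<epsilon> i = 1)\<close> keeps \<open>s\<close> for the sign 1 and flips it for the
  sign -1.\<close>

lemma spm_dvec: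
  assumes "\<epsilon> i = 1 \<or> \<epsilon> i = - 1"
  shows "spm \<sigma> \<epsilon> *v dvec (i, s) = dvec (\<sigma> i, s = (\<epsilon> i = 1))"
proof -
  have "(spm \<sigma> \<epsilon> *v dvec (i, s)) $ r = dvec (\<sigma> i, s = (\<epsilon> i = 1)) $ r" for r
  proof -
    have "(spm \<sigma> \<epsilon> *v dvec (i, s)) $ r
        = (\<Sum>c\<in>UNIV. if c = i then (if r = \<sigma> i then \<epsilon> i else 0) * (if s then 1 else - 1) else 0)"
      unfolding matrix_vector_mult_def vec_lambda_beta
      by (rule sum.cong) (auto simp: spm_def dvec_component)
    also have "\<dots> = dvec (\<sigma> i, s = (\<epsilon> i = 1)) $ r"
      using assms by (auto simp: dvec_component)
    finally show ?thesis .
  qed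
  then show ?thesis
    by (simp add: vec_eq_iff)
qed

lemma orthogonal_matrix_spm:
  assumes bij: "bij \<sigma>" and \<epsilon>: "\<And>i. \<epsilon> i = 1 \<or> \<epsilon> i = - 1"
  shows "orthogonal_matrix (spm \<sigma> \<epsilon>)"
proof -
  have sq: "\<epsilon> i * \<epsilon> i = 1" for i
    using \<epsilon>[of i] by auto
  have inj: "\<sigma> i = \<sigma> j \<longleftrightarrow> i = j" for i j
    using bij by (simp add: bij_def inj_eq)
  have "(transpose (spm \<sigma> \<epsilon>) ** spm \<sigma> \<epsilon>) $ i $ j = mat 1 $ i $ j" for i j
  proof -
    have "(transpose (spm \<sigma> \<epsilon>) ** spm \<sigma> \<epsilon>) $ i $ j
        = (\<Sum>k\<in>UNIV. if k = \<sigma> i then \<epsilon> i * (if \<sigma> i = \<sigma> j then \<epsilon> j else 0) else 0)"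
      unfolding matrix_matrix_mult_def vec_lambda_beta
      by (rule sum.cong) (auto simp: spm_def transpose_def)
    also have "\<dots> = mat 1 $ i $ j"
      by (auto simp: mat_def inj sq)
    finally show ?thesis .
  qed
  moreover have "(spm \<sigma> \<epsilon> ** transpose (spm \<sigma> \<epsilon>)) $ i $ j = mat 1 $ i $ j" for i j
  proof -
    obtain i' where i': "i = \<sigma> i'"
      using bij by (meson bij_pointE)
    have "(spm \<sigma> \<epsilon> ** transpose (spm \<sigma> \<epsilon>)) $ i $ j
        = (\<Sum>k\<in>UNIV. if k = i' then \<epsilon> i' * (if j = i then \<epsilon> i' else 0) else 0)"
      unfolding matrix_matrix_mult_def vec_lambda_beta
      by (rule sum.cong) (auto simp: spm_def transpose_def i' inj)
    also have "\<dots> = mat 1 $ i $ j"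
      by (auto simp: mat_def sq)
    finally show ?thesis .
  qed
  ultimately show ?thesis
    unfolding orthogonal_matrix_def vec_eq_iff by blast
qed

lemma det_spm_cases:
  assumes "bij \<sigma>" and "\<And>i. \<epsilon> i = 1 \<or> \<epsilon> i = - 1"
  shows "det (spm \<sigma> \<epsilon>) = 1 \<or> det (spm \<sigma> \<epsilon>) = - 1"
proof -
  have "det (transpose (spm \<sigma> \<epsilon>) ** spm \<sigma> \<epsilon>) = 1"
    using orthogonal_matrix_spm[OF assms] by (simp add: orthogonal_matrix_def)
  then have "det (spm \<sigma> \<epsilon>) * det (spm \<sigma> \<epsilon>) = 1"
    by (simp add: det_mul)
  then show ?thesis
    by (metis zmult_eq_1_iff)
qed

lemma det_spm_reflection: "det (spm id (\<lambda>j. if j = i then - 1 else 1)) = - 1"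
proof -
  have "det (spm id (\<lambda>j. if j = i then - 1 else 1)) = (\<Prod>j\<in>UNIV. if j = i then - 1 else 1)"
    by (subst det_diagonal) (auto simp: spm_def intro!: prod.cong)
  also have "\<dots> = - 1"
    by (subst prod.remove[of _ i]) auto
  finally show ?thesis .
qed

lemma det_spm_transpose:
  assumes "i \<noteq> j"
  shows "det (spm (Transposition.transpose i j) (\<lambda>_. 1)) = - 1"
proof -
  define p where "p = Transposition.transpose i j"
  have perm: "p permutes UNIV"
    by (simp add: p_def permutes_swap_id)
  have "spm p (\<lambda>_. 1) = (\<chi> r c. (mat 1 :: int ^ 'a ^ 'a) $ r $ p c)"
    by (simp add: spm_def mat_def)
  then have "det (spm p (\<lambda>_. 1)) = of_int (sign p) * det (mat 1 :: int ^ 'a ^ 'a)"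
    by (simp only: det_permute_columns[OF perm])
  then show ?thesis
    using assms by (simp add: p_def sign_swap_id)
qed

lemma orthogonal_matrix_mult_int:
  fixes P Q :: "int ^ 'n::finite ^ 'n"
  assumes "orthogonal_matrix P" and "orthogonal_matrix Q"
  shows "orthogonal_matrix (P ** Q)"
proof -
  have "transpose (P ** Q) ** (P ** Q) = transpose Q ** (transpose P ** P) ** Q"
    by (simp add: matrix_transpose_mul matrix_mul_assoc)
  moreover have "(P ** Q) ** transpose (P ** Q) = P ** (Q ** transpose Q) ** transpose P"
    by (simp add: matrix_transpose_mul matrix_mul_assoc)
  ultimately show ?thesis
    using assms by (simp add: orthogonal_matrix_def)
qed

lemma spm_star:
  assumes "\<And>i. \<epsilon> i = 1 \<or> \<epsilon> i = - 1"
  shows "(*v) (spm \<sigma> \<epsilon>) ` star A = star ((\<lambda>(i, s). (\<sigma> i, s = (\<epsilon> i = 1))) ` A)"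
proof -
  have "(*v) (spm \<sigma> \<epsilon>) ` dvec ` A = dvec ` (\<lambda>(i, s). (\<sigma> i, s = (\<epsilon> i = 1))) ` A"
    unfolding image_image by (rule image_cong) (auto simp: spm_dvec assms)
  then show ?thesis
    by (simp add: star_def)
qed


section \<open>Every star is a copy of a canonical star\<close>

abbreviation num :: "'n::finite \<Rightarrow> nat" where
  "num \<equiv> to_nat_on UNIV"

lemma bij_num: "bij_betw (num :: 'n::finite \<Rightarrow> nat) UNIV {..<CARD('n)}"
  by (simp add: to_nat_on_finite)

lemma num_less [simp]: "num (i :: 'n::finite) < CARD('n)"
  using bij_betwE[OF bij_num[where 'n='n]] by auto

lemma ex_num: "k < CARD('n) \<Longrightarrow> \<exists>i :: 'n::finite. num i = k"
  using bij_num[where 'n='n] unfolding bij_betw_def by (metis imageE lessThan_iff)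

lemma card_num_vimage:
  assumes "m \<le> CARD('n)"
  shows "card {i :: 'n::finite. l \<le> num i \<and> num i < m} = m - l"
proof -
  have "num ` {i :: 'n. l \<le> num i \<and> num i < m} = {l..<m}"
    using assms ex_num[where 'n='n] by (auto simp: image_iff) (metis order_less_le_trans)
  moreover have "inj_on num {i :: 'n. l \<le> num i \<and> num i < m}"
    by (auto simp: inj_on_def)
  ultimately show ?thesis
    by (metis card_atLeastLessThan card_image)
qed

definition arms :: "nat \<times> nat \<Rightarrow> ('n::finite \<times> bool) set" where
  "arms = (\<lambda>(a, b). {(i, s). num i < a \<or> num i < a + b \<and> s})"

definition star_types :: "'n::finite itself \<Rightarrow> (nat \<times> nat) set" where
  "star_types _ = {(a, b). 0 < a + b \<and> a + b \<le> CARD('n)}"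

text \<open>The axes fall into three classes: two arms (\<open>D\<close>), one arm
  (\<open>M\<close>), none. The permutation is glued from bijections between the classes of the
  canonical star and those of \<open>A\<close>, which have equal sizes by the choice of
  \<open>a\<close> and \<open>b\<close>.\<close>

lemma ex_star_isometry:
  fixes A :: "('n::finite \<times> bool) set"
  assumes A: "A \<noteq> {}"
  shows "\<exists>t\<in>star_types TYPE('n). \<exists>\<sigma> \<epsilon>. bij \<sigma> \<and> (\<forall>i. \<epsilon> i = 1 \<or> \<epsilon> i = - 1) \<and>
    (*v) (spm \<sigma> \<epsilon>) ` star (arms t) = star A"
proof -
  define D where "D = {i. (i, True) \<in> A \<and> (i, False) \<in> A}"
  define M where "M = {i. ((i, True) \<in> A) \<noteq> ((i, False) \<in> A)}"
  have [simp]: "finite D" "finite M" "D \<inter> M = {}"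
    by (auto simp: D_def M_def)
  define a where "a = card D"
  define b where "b = card M"
  have ab: "card (D \<union> M) = a + b"
    by (simp add: card_Un_disjoint a_def b_def)
  then have le: "a + b \<le> CARD('n)"
    by (metis card_mono finite top_greatest)
  obtain i s where "(i, s) \<in> A"
    using A by auto
  then have "i \<in> D \<union> M"
    by (cases s) (auto simp: D_def M_def)
  then have "card (D \<union> M) \<noteq> 0"
    by auto
  then have t: "(a, b) \<in> star_types TYPE('n)"
    using le ab by (simp add: star_types_def)
  have "card {i :: 'n. num i < a} = card D"
    using card_num_vimage[where 'n='n, of a 0] le by (simp add: a_def)
  then obtain f where f: "bij_betw f {i :: 'n. num i < a} D"
    using bij_betw_iff_card[of "{i :: 'n. num i < a}" D] by auto
  have "card {i :: 'n. a \<le> num i \<and> num i < a + b} = card M"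
    using card_num_vimage[where 'n='n, of "a + b" a] le by (simp add: b_def)
  then obtain g where g: "bij_betw g {i :: 'n. a \<le> num i \<and> num i < a + b} M"
    using bij_betw_iff_card[of "{i :: 'n. a \<le> num i \<and> num i < a + b}" M] by auto
  have "card {i :: 'n. a + b \<le> num i} = card (- (D \<union> M))"
    using card_num_vimage[where 'n='n, of "CARD('n)" "a + b"] ab
    by (simp add: Compl_eq_Diff_UNIV card_Diff_subset)
  then obtain h where h: "bij_betw h {i :: 'n. a + b \<le> num i} (- (D \<union> M))"
    using bij_betw_iff_card[of "{i :: 'n. a + b \<le> num i}" "- (D \<union> M)"] by auto
  define \<sigma> where "\<sigma> i = (if num i < a then f i else if num i < a + b then g i else h i)" for i
  have f': "bij_betw \<sigma> {i :: 'n. num i < a} D"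
    using f by (rule bij_betw_cong[THEN iffD2, rotated]) (auto simp: \<sigma>_def)
  have g': "bij_betw \<sigma> {i :: 'n. a \<le> num i \<and> num i < a + b} M"
    using g by (rule bij_betw_cong[THEN iffD2, rotated]) (auto simp: \<sigma>_def)
  have h': "bij_betw \<sigma> {i :: 'n. a + b \<le> num i} (- (D \<union> M))"
    using h by (rule bij_betw_cong[THEN iffD2, rotated]) (auto simp: \<sigma>_def)
  have "bij_betw \<sigma> ({i. num i < a} \<union> {i. a \<le> num i \<and> num i < a + b} \<union> {i. a + b \<le> num i})
      (D \<union> M \<union> - (D \<union> M))"
    by (intro bij_betw_combine f' g' h') auto
  moreover have "{i. num i < a} \<union> {i. a \<le> num i \<and> num i < a + b} \<union> {i. a + b \<le> num i} = (UNIV :: 'n set)"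
    by auto
  ultimately have bij: "bij \<sigma>"
    by (simp only: Compl_partition)
  \<comment> \<open>The sign matters only for axes mapped into \<open>M\<close>, where it sends the
    positive canonical arm to the arm that \<open>A\<close> has. On the other axes either sign would
    do.\<close>
  define \<epsilon> :: "'n \<Rightarrow> int" where "\<epsilon> i = (if (\<sigma> i, True) \<in> A then 1 else - 1)" for i
  have \<epsilon>: "\<epsilon> i = 1 \<or> \<epsilon> i = - 1" for i
    by (simp add: \<epsilon>_def)
  have mem: "(\<sigma> i, s = (\<epsilon> i = 1)) \<in> A \<longleftrightarrow> (i, s) \<in> arms (a, b)" for i s
  proof -
    consider "num i < a" | "a \<le> num i" "num i < a + b" | "a + b \<le> num i"
      by linarith
    then show ?thesis
    proof cases
      case 1
      then have "\<sigma> i \<in> D"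
        using f' by (auto simp: bij_betw_def)
      then show ?thesis
        using 1 by (cases "s = (\<epsilon> i = 1)") (auto simp: D_def arms_def)
    next
      case 2
      then have "\<sigma> i \<in> M"
        using g' by (auto simp: bij_betw_def)
      then show ?thesis
        using 2 by (cases s) (auto simp: M_def arms_def \<epsilon>_def)
    next
      case 3
      then have "\<sigma> i \<in> - (D \<union> M)"
        using h' by (auto simp: bij_betw_def)
      then show ?thesis
        using 3 by (cases "s = (\<epsilon> i = 1)") (auto simp: D_def M_def arms_def)
    qed
  qed
  have "(\<lambda>(i, s). (\<sigma> i, s = (\<epsilon> i = 1))) ` arms (a, b) = A"
  proof (intro equalityI subsetI)
    fix p assume p: "p \<in> A"
    obtain i where i: "fst p = \<sigma> i"
      using bij by (metis bij_pointE)
    have "p = (\<sigma> i, (snd p = (\<epsilon> i = 1)) = (\<epsilon> i = 1))"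
      using i by (auto simp: prod_eq_iff)
    moreover from this have "(i, snd p = (\<epsilon> i = 1)) \<in> arms (a, b)"
      using mem[of i "snd p = (\<epsilon> i = 1)"] p by argo
    ultimately show "p \<in> (\<lambda>(i, s). (\<sigma> i, s = (\<epsilon> i = 1))) ` arms (a, b)"
      by (intro image_eqI[of _ _ "(i, snd p = (\<epsilon> i = 1))"]) auto
  qed (use mem in auto)
  then have "(*v) (spm \<sigma> \<epsilon>) ` star (arms (a, b)) = star A"
    by (simp add: spm_star \<epsilon>)
  with t bij \<epsilon> show ?thesis
    by blast
qed

text \<open>An axis with two arms or none can be reflected. If there is none, then
  \<open>a = 0\<close> and \<open>b\<close> is the dimension, so all arms are positive, one per
  axis, and the first two axes can be exchanged.\<close>

lemma ex_improper_symmetry: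
  assumes "CARD('n::finite) \<ge> 2" and t: "t \<in> star_types TYPE('n)"
  shows "\<exists>F :: int ^ 'n ^ 'n. orthogonal_matrix F \<and> det F = - 1 \<and> (*v) F ` star (arms t) = star (arms t)"
proof -
  obtain a b where ab: "t = (a, b)" "0 < a + b" "a + b \<le> CARD('n)"
    using t by (auto simp: star_types_def)
  show ?thesis
  proof (cases "0 < a \<or> a + b < CARD('n)")
    case True
    then obtain i :: 'n where i: "num i < a \<or> a + b \<le> num i"
      using ex_num[of 0, where 'n='n] ex_num[of "a + b", where 'n='n] by (metis le_refl zero_less_card_finite)
    define \<epsilon> :: "'n \<Rightarrow> int" where "\<epsilon> = (\<lambda>j. if j = i then - 1 else 1)"
    have \<epsilon>: "\<epsilon> j = 1 \<or> \<epsilon> j = - 1" for j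
      by (simp add: \<epsilon>_def)
    have mem: "(j, s = (\<epsilon> j = 1)) \<in> arms t \<longleftrightarrow> (j, s) \<in> arms t" for j s
      using i by (auto simp: arms_def ab \<epsilon>_def)
    have "(\<lambda>(j, s). (id j, s = (\<epsilon> j = 1))) ` arms t = (arms t :: ('n \<times> bool) set)"
    proof (intro equalityI subsetI)
      fix p :: "'n \<times> bool" assume "p \<in> arms t"
      then show "p \<in> (\<lambda>(j, s). (id j, s = (\<epsilon> j = 1))) ` arms t"
        using mem[of "fst p" "snd p"]
        by (intro image_eqI[of _ _ "(fst p, snd p = (\<epsilon> (fst p) = 1))"]) (auto simp: prod_eq_iff)
    qed (use mem in auto)
    then have "(*v) (spm id \<epsilon>) ` star (arms t) = star (arms t)"
      by (simp only: spm_star[OF \<epsilon>])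
    moreover have "orthogonal_matrix (spm id \<epsilon>)"
      by (intro orthogonal_matrix_spm bij_id \<epsilon>)
    moreover have "det (spm id \<epsilon>) = - 1"
      unfolding \<epsilon>_def by (rule det_spm_reflection)
    ultimately show ?thesis
      by blast
  next
    case False
    with ab have a: "a = 0" "b = CARD('n)"
      by auto
    obtain i j :: 'n where "num i = 0" "num j = 1"
      using ex_num[of 0, where 'n='n] ex_num[of 1, where 'n='n] assms(1) by force
    then have ij: "i \<noteq> j"
      by auto
    define \<sigma> where "\<sigma> = Transposition.transpose i j"
    have bij: "bij \<sigma>"
      by (simp add: \<sigma>_def)
    have "(\<lambda>(i, s). (\<sigma> i, s = ((1::int) = 1))) ` arms t = (arms t :: ('n \<times> bool) set)"
    proof (intro equalityI subsetI)
      fix p :: "'n \<times> bool" assume "p \<in> arms t"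
      moreover obtain k where "fst p = \<sigma> k"
        using bij by (metis bij_pointE)
      ultimately show "p \<in> (\<lambda>(i, s). (\<sigma> i, s = ((1::int) = 1))) ` arms t"
        by (intro image_eqI[of _ _ "(k, snd p)"]) (auto simp: arms_def ab a prod_eq_iff)
    qed (auto simp: arms_def ab a)
    then have "(*v) (spm \<sigma> (\<lambda>_. 1)) ` star (arms t) = star (arms t)"
      by (subst spm_star) auto
    moreover have "orthogonal_matrix (spm \<sigma> (\<lambda>_. 1))"
      by (intro orthogonal_matrix_spm bij) simp
    moreover have "det (spm \<sigma> (\<lambda>_. 1)) = - 1"
      unfolding \<sigma>_def using ij by (rule det_spm_transpose)
    ultimately show ?thesis
      by blast
  qed
qed

text \<open>If the isometry found has determinant -1, composing it with an improper symmetry of the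
  canonical star does not change the image and makes the determinant 1.\<close>

lemma ex_star_rotation:
  fixes A :: "('n::finite \<times> bool) set"
  assumes "CARD('n) \<ge> 2" and "A \<noteq> {}"
  shows "\<exists>t\<in>star_types TYPE('n). \<exists>Q :: int ^ 'n ^ 'n. rotation_matrix Q \<and> (*v) Q ` star (arms t) = star A"
proof -
  obtain t \<sigma> \<epsilon> where t: "t \<in> star_types TYPE('n)" and bij: "bij \<sigma>"
    and \<epsilon>: "\<And>i. \<epsilon> i = 1 \<or> \<epsilon> i = - 1" and im: "(*v) (spm \<sigma> \<epsilon>) ` star (arms t) = star A"
    using ex_star_isometry[OF assms(2)] by blast
  have orth: "orthogonal_matrix (spm \<sigma> \<epsilon>)"
    using bij \<epsilon> by (rule orthogonal_matrix_spm)
  show ?thesis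
  proof (cases "det (spm \<sigma> \<epsilon>) = 1")
    case True
    then show ?thesis
      using t im orth by (intro bexI[of _ t] exI[of _ "spm \<sigma> \<epsilon>"]) (simp_all add: rotation_matrix_def)
  next
    case False
    then have det: "det (spm \<sigma> \<epsilon>) = - 1"
      using det_spm_cases[of \<sigma> \<epsilon>] bij \<epsilon> by blast
    obtain F :: "int ^ 'n ^ 'n" where F: "orthogonal_matrix F" "det F = - 1"
      "(*v) F ` star (arms t) = star (arms t)"
      using ex_improper_symmetry[OF assms(1) t] by blast
    have "(*v) (spm \<sigma> \<epsilon> ** F) ` star (arms t) = (*v) (spm \<sigma> \<epsilon>) ` (*v) F ` star (arms t)"
      by (simp add: image_image matrix_vector_mul_assoc)
    then have "(*v) (spm \<sigma> \<epsilon> ** F) ` star (arms t) = star A"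
      using F im by simp
    moreover have "rotation_matrix (spm \<sigma> \<epsilon> ** F)"
      using orthogonal_matrix_mult_int[OF orth F(1)] F det by (simp add: rotation_matrix_def det_mul)
    ultimately show ?thesis
      using t by (intro bexI[of _ t] exI[of _ "spm \<sigma> \<epsilon> ** F"]) simp_all
  qed
qed


section \<open>Counting the canonical stars\<close>

text \<open>
  Injective affine maps commute with this construction, and for a star it yields the arms whose
  opposite is also an arm. Together with the number of cubes it determines the type of the star.
\<close>

definition antipodes :: "'a::ab_group_add set \<Rightarrow> 'a set" where
  "antipodes T = {x\<in>T. \<exists>m\<in>T. \<exists>z\<in>T. x \<noteq> z \<and> x + z = m + m}"

lemma antipodes_place:
  fixes Q :: "int ^ 'n::finite ^ 'n"
  assumes "inj ((*v) Q)"
  shows "antipodes (place Q v T) = place Q v (antipodes T)"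
proof -
  define f where "f c = Q *v c + v" for c
  have sum: "f x + f z = Q *v (x + z) + (v + v)" for x z
    by (simp add: f_def matrix_vector_right_distrib)
  have eq: "f x + f z = f m + f m \<longleftrightarrow> x + z = m + m" for x z m
    unfolding sum add_right_cancel by (rule inj_eq[OF assms])
  then have eq': "f x + f z = 2 * f m \<longleftrightarrow> x + z = 2 * m" for x z m
    by (metis mult_2)
  have ne: "f x = f z \<longleftrightarrow> x = z" for x z
    unfolding f_def add_right_cancel by (rule inj_eq[OF assms])
  have "antipodes (f ` T) = f ` antipodes T"
    unfolding antipodes_def by (auto simp: eq' ne) blast+
  then show ?thesis
    by (simp add: place_def f_def)
qed

text \<open>The midpoint \<open>m\<close> must be the centre of the star: if it were an arm along
  axis \<open>i\<close>, then \<open>x\<close> and \<open>z\<close> would have coordinates in axis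
  \<open>i\<close> that sum to 2 or -2 and are at most 1 in absolute value. Both would then be that
  arm, contradicting \<open>x \<noteq> z\<close>. Hence \<open>z = - x\<close>.\<close>

lemma antipodes_star: "antipodes (star A) = dvec ` {(i, s). (i, s) \<in> A \<and> (i, \<not> s) \<in> A}"
proof (intro equalityI subsetI)
  fix x assume "x \<in> antipodes (star A)"
  then obtain m z where x: "x \<in> star A" and m: "m \<in> star A" and z: "z \<in> star A"
    and xz: "x \<noteq> z" and eq: "x + z = m + m"
    by (auto simp: antipodes_def)
  have small: "\<bar>w $ j\<bar> \<le> 1" and uniq: "w $ j \<noteq> 0 \<Longrightarrow> k \<noteq> j \<Longrightarrow> w $ k = 0"
    if "w \<in> star A" for w j k
    using that by (auto simp: star_def dvec_component split: if_splits)
  have m0: "m = 0"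
  proof (rule ccontr)
    assume "m \<noteq> 0"
    then obtain i s where m': "m = dvec (i, s)"
      using m by (auto simp: star_def)
    have "x $ i + z $ i = m $ i + m $ i"
      using eq by (metis vector_add_component)
    then have i: "x $ i = m $ i" "z $ i = m $ i"
      using small[OF x, of i] small[OF z, of i] by (auto simp: m' dvec_component split: if_splits)
    then have "x $ i \<noteq> 0" "z $ i \<noteq> 0"
      by (auto simp: m' dvec_component)
    then have "x $ k = z $ k" for k
      using uniq[OF x, of i k] uniq[OF z, of i k] i by (cases "k = i") auto
    with xz show False
      by (simp add: vec_eq_iff)
  qed
  with eq have z': "z = - x"
    by (simp add: eq_neg_iff_add_eq_0 add.commute)
  with xz have "x \<noteq> 0"
    by auto
  then obtain i s where p: "(i, s) \<in> A" "x = dvec (i, s)"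
    using x by (auto simp: star_def)
  then have "z = dvec (i, \<not> s)"
    using z' uminus_dvec by simp
  then have "(i, \<not> s) \<in> A"
    using z inj_dvec by (auto simp: star_def dest: injD)
  with p show "x \<in> dvec ` {(i, s). (i, s) \<in> A \<and> (i, \<not> s) \<in> A}"
    by auto
next
  fix x assume "x \<in> dvec ` {(i, s). (i, s) \<in> A \<and> (i, \<not> s) \<in> A}"
  then obtain i s where p: "(i, s) \<in> A" "(i, \<not> s) \<in> A" "x = dvec (i, s)"
    by auto
  have "dvec (i, s) \<noteq> dvec (i, \<not> s)"
    by (auto dest: injD[OF inj_dvec])
  moreover have "dvec (i, s) + dvec (i, \<not> s) = 0 + 0"
    by (simp flip: uminus_dvec)
  ultimately show "x \<in> antipodes (star A)"
    using p unfolding antipodes_def star_def by blast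
qed

lemma card_antipodes_star_arms:
  assumes "a + b \<le> CARD('n)"
  shows "card (antipodes (star (arms (a, b) :: ('n::finite \<times> bool) set))) = 2 * a"
proof -
  have "{(i, s). (i, s) \<in> arms (a, b) \<and> (i, \<not> s) \<in> arms (a, b)}
      = {i :: 'n. 0 \<le> num i \<and> num i < a} \<times> UNIV"
    by (auto simp: arms_def)
  then show ?thesis
    using card_num_vimage[where 'n='n, of a 0] assms
    by (simp add: antipodes_star card_image[OF inj_on_subset[OF inj_dvec]] card_cartesian_product)
qed

lemma card_arms:
  assumes "a + b \<le> CARD('n)"
  shows "card (arms (a, b) :: ('n::finite \<times> bool) set) = 2 * a + b"
proof -
  have "arms (a, b) = {i :: 'n. 0 \<le> num i \<and> num i < a} \<times> UNIV \<union>
      {i :: 'n. a \<le> num i \<and> num i < a + b} \<times> {True}"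
    by (auto simp: arms_def)
  then show ?thesis
    using card_num_vimage[where 'n='n, of a 0] card_num_vimage[where 'n='n, of "a + b" a] assms
    by (simp, subst card_Un_disjoint) (auto simp: card_cartesian_product)
qed

lemma inj_rotation:
  fixes Q :: "int ^ 'n::finite ^ 'n"
  assumes "rotation_matrix Q"
  shows "inj ((*v) Q)"
proof (rule inj_on_inverseI)
  show "transpose Q *v (Q *v x) = x" for x
    using assms by (simp add: rotation_matrix_def orthogonal_matrix_def matrix_vector_mul_assoc)
qed

lemma is_copy_star_arms:
  assumes t: "t \<in> star_types TYPE('n::finite)" "t' \<in> star_types TYPE('n)"
    and copy: "is_copy (star (arms t :: ('n \<times> bool) set)) (star (arms t'))"
  shows "t = t'"
proof -
  obtain a b a' b' where ab: "t = (a, b)" "t' = (a', b')" "a + b \<le> CARD('n)" "a' + b' \<le> CARD('n)"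
    using t by (auto simp: star_types_def)
  let ?T = "star (arms t) :: (int ^ 'n) set" and ?T' = "star (arms t') :: (int ^ 'n) set"
  obtain Q v where Q: "rotation_matrix Q" and eq: "?T' = place Q v ?T"
    using copy by (auto simp: is_copy_def)
  have inj: "inj (\<lambda>c. Q *v c + v)"
    using inj_rotation[OF Q] by (simp add: inj_def)
  have "card ?T' = card ?T"
    unfolding eq place_def by (rule card_image) (rule inj_on_subset[OF inj subset_UNIV])
  moreover have "card (antipodes ?T') = card (antipodes ?T)"
    unfolding eq antipodes_place[OF inj_rotation[OF Q]] unfolding place_def
    by (rule card_image) (rule inj_on_subset[OF inj subset_UNIV])
  ultimately have "Suc (2 * a' + b') = Suc (2 * a + b)" and "2 * a' = 2 * a"
    by (simp_all only: ab(1,2) card_star card_arms[OF ab(3)] card_arms[OF ab(4)]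
        card_antipodes_star_arms[OF ab(3)] card_antipodes_star_arms[OF ab(4)])
  then show ?thesis
    using ab by simp
qed

lemma is_copy_refl: "is_copy T T"
proof -
  have "rotation_matrix (mat 1 :: int ^ 'a ^ 'a)"
    by (simp add: rotation_matrix_def orthogonal_matrix_id)
  moreover have "T = place (mat 1) 0 T"
    by (simp add: place_def)
  ultimately show ?thesis
    unfolding is_copy_def by blast
qed

lemma inj_on_star_arms: "inj_on (\<lambda>t. star (arms t) :: (int ^ 'n::finite) set) (star_types TYPE('n))"
proof (rule inj_onI)
  fix t t'
  assume t: "t \<in> star_types TYPE('n)" "t' \<in> star_types TYPE('n)"
    and eq: "star (arms t :: ('n \<times> bool) set) = star (arms t')"
  show "t = t'"
    using is_copy_refl by (intro is_copy_star_arms[OF t]) (simp add: eq)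
qed

lemma finite_star_types [simp]: "finite (star_types TYPE('n::finite))"
proof (rule finite_subset)
  show "star_types TYPE('n) \<subseteq> {..CARD('n)} \<times> {..CARD('n)}"
    by (auto simp: star_types_def)
qed simp

lemma card_star_types: "card (star_types TYPE('n::finite)) = CARD('n) * (CARD('n) + 3) div 2"
proof -
  let ?d = "CARD('n)"
  \<comment> \<open>Adding the excluded pair completes the triangle of all pairs with sum at most d,
    which has (d + 1)(d + 2)/2 elements, one more than d(d + 3)/2.\<close>
  have "insert (0, 0) (star_types TYPE('n)) = Sigma {..?d} (\<lambda>a. {..?d - a})"
    by (auto simp: star_types_def)
  then have "card (insert (0, 0) (star_types TYPE('n))) = (\<Sum>a\<le>?d. Suc (?d - a))"
    by (simp add: card_SigmaI)
  also have "\<dots> = (\<Sum>a\<le>?d. Suc a)"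
    by (rule sum.reindex_bij_witness[of _ "\<lambda>a. ?d - a" "\<lambda>a. ?d - a"]) auto
  also have "\<dots> = Suc ?d * (Suc ?d + 1) div 2"
  proof -
    have *: "2 * (\<Sum>a\<le>m. Suc a) = Suc m * (Suc m + 1)" for m
      by (induction m) auto
    show ?thesis
      by (subst *[symmetric]) simp
  qed
  finally have "Suc (card (star_types TYPE('n))) = Suc ?d * (Suc ?d + 1) div 2"
    by (subst (asm) card_insert_disjoint) (simp_all, simp add: star_types_def)
  moreover have "Suc ?d * (Suc ?d + 1) = ?d * (?d + 3) + 2 * 1"
    by (simp add: algebra_simps)
  ultimately show ?thesis
    by simp
qed

lemma tile_set_stars: "tile_set ((\<lambda>t. star (arms t) :: (int ^ 'n::finite) set) ` star_types TYPE('n))"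
proof -
  have "arms t \<noteq> ({} :: ('n \<times> bool) set)" if t: "t \<in> star_types TYPE('n)" for t
  proof -
    obtain a b where "t = (a, b)" "0 < a + b" "a + b \<le> CARD('n)"
      using t by (auto simp: star_types_def)
    then have "card (arms t :: ('n \<times> bool) set) \<noteq> 0"
      by (auto simp: card_arms)
    then show ?thesis
      by force
  qed
  moreover have "t = t'" if "t \<in> star_types TYPE('n)" "t' \<in> star_types TYPE('n)"
    and "is_copy (star (arms t :: ('n \<times> bool) set)) (star (arms t'))" for t t'
    using that by (rule is_copy_star_arms)
  ultimately show ?thesis
    unfolding tile_set_def pairwise_def ball_simps
    using tile_star not_singleton_star by blast
qed

section \<open>Reasoning about programs\<close>

fun loop_free :: "ram_prog \<Rightarrow> bool" where
  "loop_free (Seq p q) \<longleftrightarrow> loop_free p \<and> loop_free q"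
| "loop_free (IfPos r p q) \<longleftrightarrow> loop_free p \<and> loop_free q"
| "loop_free (WhilePos r p) \<longleftrightarrow> False"
| "loop_free p \<longleftrightarrow> True"

fun writes :: "ram_prog \<Rightarrow> reg set" where
  "writes (Const r k) = {r}"
| "writes (Add r a b) = {r}"
| "writes (Sub r a b) = {r}"
| "writes (Load r a) = {r}"
| "writes (Store a r) = {}"
| "writes (Seq p q) = writes p \<union> writes q"
| "writes (IfPos r p q) = writes p \<union> writes q"
| "writes (WhilePos r p) = writes p"

fun stores :: "ram_prog \<Rightarrow> bool" where
  "stores (Store a r) \<longleftrightarrow> True"
| "stores (Seq p q) \<longleftrightarrow> stores p \<or> stores q"
| "stores (IfPos r p q) \<longleftrightarrow> stores p \<or> stores q"
| "stores (WhilePos r p) \<longleftrightarrow> stores p"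
| "stores p \<longleftrightarrow> False"

text \<open>Only meaningful for loop-free programs: the equation for loops is a dummy.\<close>

fun sem :: "ram_prog \<Rightarrow> ram_state \<Rightarrow> ram_state" where
  "sem (Const r k) s = ((fst s)(r := k), snd s)"
| "sem (Add r a b) s = ((fst s)(r := fst s a + fst s b), snd s)"
| "sem (Sub r a b) s = ((fst s)(r := fst s a - fst s b), snd s)"
| "sem (Load r a) s = ((fst s)(r := snd s (fst s a)), snd s)"
| "sem (Store a r) s = (fst s, (snd s)(fst s a := fst s r))"
| "sem (Seq p q) s = sem q (sem p s)"
| "sem (IfPos r p q) s = (if fst s r > 0 then sem p s else sem q s)"
| "sem (WhilePos r p) s = s"

lemma sem_frame: "r \<notin> writes p \<Longrightarrow> fst (sem p s) r = fst s r"
  by (induction p arbitrary: s) auto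

lemma sem_no_store: "\<not> stores p \<Longrightarrow> snd (sem p s) = snd s"
  by (induction p arbitrary: s) auto

text \<open>Without loops no instruction is executed twice, so one constant, depending on the
  program only, bounds the time from every state. Only iteration counts need attention
  afterwards.\<close>

lemma exec_sem:
  assumes "loop_free p"
  shows "\<exists>C. \<forall>s. \<exists>t\<le>C. exec p s t (sem p s)"
  using assms
proof (induction p)
  case (Seq p q)
  then obtain C D where "\<forall>s. \<exists>t\<le>C. exec p s t (sem p s)" "\<forall>s. \<exists>t\<le>D. exec q s t (sem q s)"
    by auto
  then have "\<exists>t\<le>C + D. exec (Seq p q) s t (sem (Seq p q) s)" for s
    by (metis exec.Seq add_mono sem.simps(6))
  then show ?case
    by blast
next
  case (IfPos r p q)
  then obtain C D where C: "\<And>s. \<exists>t\<le>C. exec p s t (sem p s)" and D: "\<And>s. \<exists>t\<le>D. exec q s t (sem q s)"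
    by auto
  have "\<exists>t\<le>C + D + 1. exec (IfPos r p q) s t (sem (IfPos r p q) s)" for s
  proof (cases "fst s r > 0")
    case True
    obtain t where "t \<le> C" "exec p s t (sem p s)"
      using C by blast
    then show ?thesis
      using True exec.IfTrue[OF True, of p t "sem p s" q] by (intro exI[of _ "t + 1"]) simp
  next
    case False
    obtain t where "t \<le> D" "exec q s t (sem q s)"
      using D by blast
    then show ?thesis
      using False exec.IfFalse[OF False, of q t "sem q s" p] by (intro exI[of _ "t + 1"]) simp
  qed
  then show ?case
    by blast
next
  case (Const r k)
  then show ?case by (metis exec.Const le_refl prod.collapse sem.simps(1))
next
  case (Add r a b)
  then show ?case by (metis exec.Add le_refl prod.collapse sem.simps(2))
next
  case (Sub r a b)
  then show ?case by (metis exec.Sub le_refl prod.collapse sem.simps(3))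
next
  case (Load r a)
  then show ?case by (metis exec.Load le_refl prod.collapse sem.simps(4))
next
  case (Store a r)
  then show ?case by (metis exec.Store le_refl prod.collapse sem.simps(5))
qed simp

text \<open>Register 2 is used for scratch values only, so that clearing it is as good as doing nothing.\<close>

definition skip :: ram_prog where
  "skip = Const 2 0"

definition seqs :: "ram_prog list \<Rightarrow> ram_prog" where
  "seqs ps = foldr Seq ps skip"

lemma seqs_simps [simp]: "seqs [] = skip" "seqs (p # ps) = Seq p (seqs ps)"
  by (simp_all add: seqs_def)

lemma skip_simps [simp]: "loop_free skip" "writes skip = {2}" "\<not> stores skip"
  "sem skip s = ((fst s)(2 := 0), snd s)"
  by (simp_all add: skip_def)

lemma loop_free_seqs [simp]: "loop_free (seqs ps) \<longleftrightarrow> (\<forall>p\<in>set ps. loop_free p)"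
  by (induction ps) auto

lemma writes_seqs [simp]: "writes (seqs ps) = insert 2 (\<Union>(writes ` set ps))"
  by (induction ps) auto

lemma stores_seqs [simp]: "stores (seqs ps) \<longleftrightarrow> (\<exists>p\<in>set ps. stores p)"
  by (induction ps) auto

definition repeat :: "reg \<Rightarrow> ram_prog \<Rightarrow> ram_prog" where
  "repeat r p = WhilePos r (Seq p (Seq (Const 2 1) (Sub r r 2)))"

text \<open>
  In a Hoare triple with linear running time, the parameter \<open>x\<close> stands for the input and \<open>len x\<close>
  for its size.
\<close>

definition lin :: "('x \<Rightarrow> nat) \<Rightarrow> ('x \<Rightarrow> ram_state \<Rightarrow> bool) \<Rightarrow> ram_prog \<Rightarrow> ('x \<Rightarrow> ram_state \<Rightarrow> bool) \<Rightarrow> bool"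
  where "lin len P p Q \<longleftrightarrow> (\<exists>C. \<forall>x s. P x s \<longrightarrow> (\<exists>t\<le>C * len x. \<exists>s'. exec p s t s' \<and> Q x s'))"

lemma lin_Seq:
  assumes "lin len P p Q" and "lin len Q q R"
  shows "lin len P (Seq p q) R"
proof -
  obtain C where C: "\<And>x s. P x s \<Longrightarrow> \<exists>t\<le>C * len x. \<exists>s'. exec p s t s' \<and> Q x s'"
    using assms(1) unfolding lin_def by blast
  obtain D where D: "\<And>x s. Q x s \<Longrightarrow> \<exists>t\<le>D * len x. \<exists>s'. exec q s t s' \<and> R x s'"
    using assms(2) unfolding lin_def by blast
  have "\<exists>t\<le>(C + D) * len x. \<exists>s'. exec (Seq p q) s t s' \<and> R x s'" if P: "P x s" for x s
  proof -
    obtain t s' where t: "t \<le> C * len x" "exec p s t s'" "Q x s'"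
      using C[OF P] by blast
    obtain u s'' where u: "u \<le> D * len x" "exec q s' u s''" "R x s''"
      using D[OF t(3)] by blast
    show ?thesis
      using t u by (intro exI[of _ "t + u"] conjI exI[of _ s''] exec.Seq) (auto simp: distrib_right)
  qed
  then show ?thesis
    unfolding lin_def by blast
qed

text \<open>Positivity of \<open>len x\<close> turns the constant bound into a linear one.\<close>

lemma lin_loop_free:
  assumes "loop_free p" and "\<And>x s. P x s \<Longrightarrow> 0 < len x \<and> Q x (sem p s)"
  shows "lin len P p Q"
proof -
  obtain C where C: "\<And>s. \<exists>t\<le>C. exec p s t (sem p s)"
    using exec_sem[OF assms(1)] by blast
  have "\<exists>t\<le>C * len x. \<exists>s'. exec p s t s' \<and> Q x s'" if P: "P x s" for x s
  proof -
    obtain t where "t \<le> C" "exec p s t (sem p s)"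
      using C by blast
    moreover have "C \<le> C * len x"
      using assms(2)[OF P] by simp
    ultimately show ?thesis
      using assms(2)[OF P] by (intro exI[of _ t] conjI exI[of _ "sem p s"]) (rule le_trans, auto)
  qed
  then show ?thesis
    unfolding lin_def by blast
qed

lemma lin_mono:
  assumes "lin len P p Q" and "\<And>x s. P' x s \<Longrightarrow> P x s" and "\<And>x s. Q x s \<Longrightarrow> Q' x s"
  shows "lin len P' p Q'"
  using assms unfolding lin_def by meson

lemma lin_seqs:
  assumes "\<And>k. k < length ps \<Longrightarrow> lin len (P k) (ps ! k) (P (Suc k))"
    and "\<And>x s. P (length ps) x s \<Longrightarrow> 0 < len x \<and> Q x ((fst s)(2 := 0), snd s)"
  shows "lin len (P 0) (seqs ps) Q"
  using assms
proof (induction ps arbitrary: P)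
  case Nil
  then show ?case
    by (intro lin_loop_free) (simp_all add: fun_upd_def)
next
  case (Cons p ps)
  have "lin len (P 0) p (P 1)"
    using Cons.prems(1)[of 0] by simp
  moreover have "lin len (P (Suc 0)) (seqs ps) Q"
    using Cons.prems(1)[of "Suc _"] Cons.prems(2) by (intro Cons.IH) auto
  ultimately show ?case
    by (auto intro: lin_Seq)
qed

text \<open>The loop's own bookkeeping changes the counter \<open>r\<close> and register 2, so
  \<open>step\<close> must establish the invariant for every register file \<open>\<rho>\<close>
  that agrees with the result of the body elsewhere.\<close>

lemma lin_repeat:
  assumes p: "loop_free p" "r \<notin> writes p" "r \<noteq> 2"
    and N: "\<And>x s. I x 0 s \<Longrightarrow> 0 < len x \<and> N x \<le> c * len x"
    and step: "\<And>x k s \<rho>. k < N x \<Longrightarrow> I x k s \<Longrightarrow> (\<And>q. q \<noteq> 2 \<Longrightarrow> q \<noteq> r \<Longrightarrow> \<rho> q = fst (sem p s) q) \<Longrightarrow>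
      I x (Suc k) (\<rho>, snd (sem p s))"
  shows "lin len (\<lambda>x s. I x 0 s \<and> fst s r = int (N x)) (repeat r p) (\<lambda>x. I x (N x))"
proof -
  define b where "b = Seq p (Seq (Const 2 1) (Sub r r 2))"
  have "loop_free b"
    using p by (simp add: b_def)
  then obtain C where C: "\<And>s. \<exists>t\<le>C. exec b s t (sem b s)"
    using exec_sem by blast
  have sem_b: "sem b s = ((fst (sem p s))(2 := 1, r := fst s r - 1), snd (sem p s))" for s
    using p(2,3) by (simp add: b_def sem_frame)
  \<comment> \<open>After \<open>k\<close> rounds \<open>m\<close> remain. Each costs at most
    \<open>C\<close> for the body with the decrement and 1 for the test; the final failing test adds
    1.\<close>
  have **: "\<exists>t\<le>(C + 1) * m + 1. \<exists>s'. exec (repeat r p) s t s' \<and> I x (N x) s'"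
    if "fst s r = int m" "I x k s" "k + m = N x" for x k m s
    using that
  proof (induction m arbitrary: k s)
    case 0
    then show ?case
      unfolding repeat_def by (intro exI[of _ 1] conjI exI[of _ s] exec.WhileFalse) auto
  next
    case (Suc m)
    obtain t where t: "t \<le> C" "exec b s t (sem b s)"
      using C by blast
    have "I x (Suc k) (sem b s)"
      unfolding sem_b using Suc.prems by (intro step) auto
    moreover have "fst (sem b s) r = int m"
      using Suc.prems(1) by (simp add: sem_b)
    ultimately obtain u s' where u: "u \<le> (C + 1) * m + 1" "exec (repeat r p) (sem b s) u s'" "I x (N x) s'"
      using Suc.IH[of "sem b s" "Suc k"] Suc.prems(3) by auto
    have e: "exec (repeat r p) s (t + u + 1) s'"
      using t(2) u(2) Suc.prems(1) unfolding repeat_def b_def[symmetric] by (intro exec.WhileTrue) auto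
    have "t + u + 1 \<le> (C + 1) * Suc m + 1"
      using t(1) u(1) by simp
    with e u(3) show ?case
      by (intro exI[of _ "t + u + 1"] conjI exI[of _ s'])
  qed
  have *: "\<exists>t\<le>(C + 1) * N x + 1. \<exists>s'. exec (repeat r p) s t s' \<and> I x (N x) s'"
    if "I x 0 s" "fst s r = int (N x)" for x s
    using that(2,1) add_0 by (rule **)
  have bound: "(C + 1) * N x + 1 \<le> ((C + 1) * c + 1) * len x" if "I x 0 s" for x s
  proof -
    have "(C + 1) * N x \<le> (C + 1) * (c * len x)"
      using N[OF that] by (intro mult_le_mono2) simp
    then show ?thesis
      using N[OF that] by (simp add: algebra_simps)
  qed
  have "\<exists>t\<le>((C + 1) * c + 1) * len x. \<exists>s'. exec (repeat r p) s t s' \<and> I x (N x) s'"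
    if I: "I x 0 s" and r: "fst s r = int (N x)" for x s
  proof -
    obtain t s' where "t \<le> (C + 1) * N x + 1" "exec (repeat r p) s t s'" "I x (N x) s'"
      using *[OF I r] by blast
    then show ?thesis
      using bound[OF I] by (intro exI[of _ t] conjI exI[of _ s']) (rule le_trans)
  qed
  then show ?thesis
    unfolding lin_def by blast
qed


section \<open>Program fragments\<close>

text \<open>
  The registers: 0 and 1 hold the number of cubes and the start of the output, 2 to 4 are scratch
  (4 also returns degrees), 5 holds the address of the current cube and 6 the position of its
  coordinates in the input, 7 is the loop counter, 8 the position at which to write next, 9 tells
  whether the current cube is a centre, 10 is the radix, 11 counts the placed tiles, 12 holds the
  address of a neighbour, and 13 is the next multiple of a weight. For every axis there are two more
  registers, for its weight and for the (shifted) start of its table.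
\<close>

definition weight_reg :: "nat \<Rightarrow> reg" where "weight_reg j = 20 + 2 * j"

definition table_reg :: "nat \<Rightarrow> reg" where "table_reg j = 21 + 2 * j"

lemma weight_reg_neq [simp]:
  "r < 20 \<Longrightarrow> weight_reg j \<noteq> r" "r < 20 \<Longrightarrow> r \<noteq> weight_reg j"
  "weight_reg j = weight_reg k \<longleftrightarrow> j = k" "weight_reg j \<noteq> table_reg k"
  by (simp_all add: weight_reg_def table_reg_def) presburger

lemma table_reg_neq [simp]:
  "r < 20 \<Longrightarrow> table_reg j \<noteq> r" "r < 20 \<Longrightarrow> r \<noteq> table_reg j"
  "table_reg j = table_reg k \<longleftrightarrow> j = k" "table_reg k \<noteq> weight_reg j"
  by (simp_all add: weight_reg_def table_reg_def) presburger

text \<open>Each term of the address is a table lookup instead of a product. The raw coordinate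
  serves as index, because the offset is already contained in \<open>table_reg j\<close>.\<close>

definition hash_prog :: "nat \<Rightarrow> ram_prog" where
  "hash_prog d = Seq (Const 5 (- int (d + 1))) (seqs (map (\<lambda>j. seqs
    [Const 2 (int j), Add 3 6 2, Load 2 3, Add 3 (table_reg j) 2, Load 2 3, Sub 5 5 2]) [0..<d]))"

lemma hash_prog_simps [simp]:
  "loop_free (hash_prog d)" "writes (hash_prog d) \<subseteq> {2, 3, 5}" "\<not> stores (hash_prog d)"
  by (auto simp: hash_prog_def)

lemma sem_hash_prog:
  "fst (sem (hash_prog d) s) 5 =
    - int (d + 1) - (\<Sum>j<d. snd s (fst s (table_reg j) + snd s (fst s 6 + int j)))"
proof -
  have "fst (sem (seqs (map (\<lambda>j. seqs [Const 2 (int j), Add 3 6 2, Load 2 3, Add 3 (table_reg j) 2,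
      Load 2 3, Sub 5 5 2]) js)) s) 5 =
    fst s 5 - (\<Sum>j\<leftarrow>js. snd s (fst s (table_reg j) + snd s (fst s 6 + int j)))" for js s
    by (induction js arbitrary: s) auto
  then show ?thesis
    by (simp add: hash_prog_def interv_sum_list_conv_sum_set_nat atLeast0LessThan)
qed

text \<open>Edge flags are 0 or 1, so their sum is the degree. An edge is stored with its lower
  endpoint; the one going down along axis \<open>j\<close> therefore lies with the neighbour below,
  whose address is larger by the weight of the axis.\<close>

definition degree_prog :: "nat \<Rightarrow> reg \<Rightarrow> ram_prog" where
  "degree_prog d r = Seq (Const 4 0) (seqs (map (\<lambda>j. seqs
    [Const 2 (1 + int j), Add 3 r 2, Load 2 3, Add 4 4 2,
     Add 3 3 (weight_reg j), Load 2 3, Add 4 4 2]) [0..<d]))"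

lemma degree_prog_simps [simp]:
  "loop_free (degree_prog d r)" "writes (degree_prog d r) \<subseteq> {2, 3, 4}" "\<not> stores (degree_prog d r)"
  by (auto simp: degree_prog_def)

lemma sem_degree_prog:
  assumes "r \<notin> {2, 3, 4}"
  shows "fst (sem (degree_prog d r) s) 4 =
    (\<Sum>j<d. snd s (fst s r + (1 + int j)) + snd s (fst s r + (1 + int j) + fst s (weight_reg j)))"
proof -
  have "fst (sem (seqs (map (\<lambda>j. seqs [Const 2 (1 + int j), Add 3 r 2, Load 2 3, Add 4 4 2,
     Add 3 3 (weight_reg j), Load 2 3, Add 4 4 2]) js)) s) 4 = fst s 4 + (\<Sum>j\<leftarrow>js.
     snd s (fst s r + (1 + int j)) + snd s (fst s r + (1 + int j) + fst s (weight_reg j)))" for js s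
    using assms by (induction js arbitrary: s) auto
  then show ?thesis
    using assms by (simp add: degree_prog_def interv_sum_list_conv_sum_set_nat atLeast0LessThan)
qed

section \<open>Pruning the adjacency graph to stars\<close>

text \<open>The pair \<open>(c, i)\<close> stands for the edge between the cubes \<open>c\<close> and \<open>c + axis i 1\<close>.\<close>

type_synonym 'n edge = "(int ^ 'n) \<times> 'n"

definition adjacencies :: "(int ^ 'n::finite) set \<Rightarrow> 'n edge set" where
  "adjacencies R = {(c, i). c \<in> R \<and> c + axis i 1 \<in> R}"

text \<open>The edges at \<open>c\<close> are coded like the arms of a star, so that
  \<open>star (dirs E c)\<close> is the neighbourhood of \<open>c\<close> in the graph, moved to the
  origin.\<close>

definition dirs :: "('n::finite) edge set \<Rightarrow> int ^ 'n \<Rightarrow> ('n \<times> bool) set" where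
  "dirs E c = {(i, s). if s then (c, i) \<in> E else (c - axis i 1, i) \<in> E}"

abbreviation deg :: "('n::finite) edge set \<Rightarrow> int ^ 'n \<Rightarrow> nat" where
  "deg E c \<equiv> card (dirs E c)"

lemma dirs_iff [simp]:
  "(i, True) \<in> dirs E c \<longleftrightarrow> (c, i) \<in> E"
  "(i, False) \<in> dirs E c \<longleftrightarrow> (c - axis i 1, i) \<in> E"
  by (simp_all add: dirs_def)

lemma dirs_mono: "E' \<subseteq> E \<Longrightarrow> dirs E' c \<subseteq> dirs E c"
  by (auto simp: dirs_def split: if_splits)

lemma degree_mono: "E' \<subseteq> E \<Longrightarrow> deg E' c \<le> deg E c"
  by (simp add: card_mono dirs_mono)

lemma dvec_True: "dvec (i, True) = axis i 1"
  by (simp add: dvec_def)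

lemma dvec_False: "dvec (i, False) = - axis i 1"
  using uminus_dvec[of i True] by (simp add: dvec_True)

lemma dirs_opposite:
  assumes "(i, s) \<in> dirs E c"
  shows "(i, \<not> s) \<in> dirs E (c + dvec (i, s))"
  using assms by (cases s) (simp_all add: dvec_True dvec_False)

lemma degree_eq_sum:
  "int (deg E c) = (\<Sum>i\<in>UNIV. of_bool ((c, i) \<in> E) + of_bool ((c - axis i 1, i) \<in> E))"
proof -
  have "dirs E c = {i. (c, i) \<in> E} \<times> {True} \<union> {i. (c - axis i 1, i) \<in> E} \<times> {False}"
    by (auto simp: dirs_def split: if_splits)
  then have "deg E c = card {i. (c, i) \<in> E} + card {i. (c - axis i 1, i) \<in> E}"
    by (simp, subst card_Un_disjoint) (auto simp: card_cartesian_product)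
  then show ?thesis
    by (simp add: sum.distrib of_bool_def sum.If_cases)
qed

definition prune :: "('n::finite) edge \<Rightarrow> 'n edge set \<Rightarrow> 'n edge set" where
  "prune = (\<lambda>(c, i) E. if (c, i) \<in> E \<and> deg E c > 1 \<and> deg E (c + axis i 1) > 1
     then E - {(c, i)} else E)"

lemma prune_subset: "prune e E \<subseteq> E"
  by (auto simp: prune_def split: prod.splits)

lemma fold_prune_subset: "fold prune es E \<subseteq> E"
  by (induction es arbitrary: E) (use prune_subset in fastforce)+

text \<open>An edge is deleted only if both endpoints have another one, and each endpoint loses a
  single direction.\<close>

lemma dirs_prune_nonempty:
  assumes "dirs E x \<noteq> {}"
  shows "dirs (prune e E) x \<noteq> {}"
proof -
  obtain c i where e: "e = (c, i)"
    by fastforce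
  show ?thesis
  proof (cases "prune e E = E")
    case False
    then have *: "prune e E = E - {(c, i)}" "deg E c > 1" "deg E (c + axis i 1) > 1"
      by (auto simp: prune_def e split: if_splits)
    have rem: "dirs (prune e E) x = dirs E x - ({p. x = c \<and> p = (i, True)} \<union> {p. x = c + axis i 1 \<and> p = (i, False)})"
      unfolding *(1) by (auto simp: dirs_def split: if_splits)
    \<comment> \<open>The endpoints differ, so no vertex loses both directions in the union
      above.\<close>
    have ne: "c \<noteq> c + axis i 1"
      using dvec_nonzero[of "(i, True)"] by (simp add: dvec_True)
    have "\<not> dirs E x \<subseteq> {p}" if "deg E x > 1" for p
      using card_mono[of "{p}" "dirs E x"] that by auto
    then show ?thesis
      unfolding rem using *(2,3) assms ne by (cases "x = c"; cases "x = c + axis i 1") auto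
  qed (use assms in simp)
qed

lemma dirs_fold_prune_nonempty: "dirs E x \<noteq> {} \<Longrightarrow> dirs (fold prune es E) x \<noteq> {}"
  by (induction es arbitrary: E) (auto simp: dirs_prune_nonempty)

definition starry :: "('n::finite) edge set \<Rightarrow> bool" where
  "starry E \<longleftrightarrow> (\<forall>(c, i)\<in>E. deg E c \<le> 1 \<or> deg E (c + axis i 1) \<le> 1)"

text \<open>An edge that survives its test has an endpoint of degree 1, and degrees never grow.\<close>

lemma fold_prune_tested:
  assumes "(c, i) \<in> set es" and "(c, i) \<in> fold prune es E"
  shows "deg (fold prune es E) c \<le> 1 \<or> deg (fold prune es E) (c + axis i 1) \<le> 1"
  using assms
proof (induction es rule: rev_induct)
  case (snoc e es)
  define E1 where "E1 = fold prune es E"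
  have eq: "fold prune (es @ [e]) E = prune e E1"
    by (simp add: E1_def)
  have mem: "(c, i) \<in> prune e E1"
    using snoc.prems(2) unfolding eq .
  then have "(c, i) \<in> E1"
    using prune_subset by blast
  have "deg E1 c \<le> 1 \<or> deg E1 (c + axis i 1) \<le> 1"
  proof (cases "(c, i) \<in> set es")
    case True
    then show ?thesis
      using snoc.IH \<open>(c, i) \<in> E1\<close> unfolding E1_def by blast
  next
    case False
    then have "e = (c, i)"
      using snoc.prems(1) by simp
    then show ?thesis
      using mem by (auto simp: prune_def split: if_splits)
  qed
  then show ?case
    unfolding eq using degree_mono[OF prune_subset[of e E1]] by (meson le_trans)
qed simp

lemma starry_fold_prune:
  assumes "E \<subseteq> set es"
  shows "starry (fold prune es E)"
proof -
  have "deg (fold prune es E) c \<le> 1 \<or> deg (fold prune es E) (c + axis i 1) \<le> 1"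
    if "(c, i) \<in> fold prune es E" for c i
    using fold_prune_tested that fold_prune_subset assms by blast
  then show ?thesis
    unfolding starry_def by blast
qed

text \<open>If both endpoints of an edge have degree 1, the lower one is taken as the centre.\<close>

definition centre :: "('n::finite) edge set \<Rightarrow> int ^ 'n \<Rightarrow> bool" where
  "centre E c \<longleftrightarrow> deg E c > 1 \<or> (\<exists>i. (c, i) \<in> E \<and> deg E (c + axis i 1) \<le> 1)"

definition cell :: "('n::finite) edge set \<Rightarrow> int ^ 'n \<Rightarrow> (int ^ 'n) set" where
  "cell E c = (\<lambda>x. x + c) ` star (dirs E c)"

lemma mem_cell_iff: "x \<in> cell E c \<longleftrightarrow> x = c \<or> (\<exists>p\<in>dirs E c. x = c + dvec p)"
  by (auto simp: cell_def star_def add.commute)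

section \<open>Components of a pruned graph as a partition into stars\<close>

locale star_graph =
  fixes E :: "('n::finite) edge set" and R :: "(int ^ 'n) set"
  assumes edges: "E \<subseteq> adjacencies R"
    and starry: "starry E"
    and covering: "c \<in> R \<Longrightarrow> dirs E c \<noteq> {}"
begin

lemma dirs_closed:
  assumes "p \<in> dirs E c"
  shows "c + dvec p \<in> R"
proof -
  obtain i s where p: "p = (i, s)"
    by fastforce
  show ?thesis
    using assms edges unfolding p by (cases s) (auto simp: adjacencies_def dvec_True dvec_False)
qed

lemma degree_neighbour:
  assumes "p \<in> dirs E c" and "deg E c > 1"
  shows "deg E (c + dvec p) \<le> 1"
proof -
  obtain i s where p: "p = (i, s)"
    by fastforce
  show ?thesis
  proof (cases s)
    case True
    then have "(c, i) \<in> E"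
      using assms by (simp add: p)
    then have "deg E c \<le> 1 \<or> deg E (c + axis i 1) \<le> 1"
      using starry unfolding starry_def by blast
    then show ?thesis
      using assms True by (simp add: p dvec_True)
  next
    case False
    then have "(c - axis i 1, i) \<in> E"
      using assms by (simp add: p)
    then have "deg E (c - axis i 1) \<le> 1 \<or> deg E (c - axis i 1 + axis i 1) \<le> 1"
      using starry unfolding starry_def by blast
    then show ?thesis
      using assms False by (simp add: p dvec_False)
  qed
qed

lemma dirs_eq_singleton:
  assumes "p \<in> dirs E c" and "deg E c \<le> 1"
  shows "dirs E c = {p}"
  using assms by (auto simp: card_le_Suc0_iff_eq)

text \<open>If \<open>c\<close> has degree at least 2, starriness bounds the degree of the
  neighbour. Otherwise \<open>c\<close> is the lower end of an isolated edge and the neighbour is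
  the upper end. A neighbour of degree 1 could be a centre only as the lower end of an edge to a
  vertex of degree 1, and both cases exclude this.\<close>

lemma leaf:
  assumes "centre E c" and p: "(i, s) \<in> dirs E c"
  shows "dirs E (c + dvec (i, s)) = {(i, \<not> s)}" and "\<not> centre E (c + dvec (i, s))"
proof -
  let ?y = "c + dvec (i, s)"
  note opp = dirs_opposite[OF p]
  have *: "deg E ?y \<le> 1 \<and> (\<not> s \<longrightarrow> deg E c > 1)"
  proof (cases "deg E c > 1")
    case True
    then show ?thesis
      using degree_neighbour[OF p] by simp
  next
    case False
    then obtain j where j: "(c, j) \<in> E" "deg E (c + axis j 1) \<le> 1"
      using assms(1) by (auto simp: centre_def)
    then have "(j, True) \<in> dirs E c"
      by simp
    moreover have "dirs E c = {(i, s)}"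
      using False by (intro dirs_eq_singleton[OF p]) simp
    ultimately have "j = i" s
      by (metis prod.inject singletonD)+
    then show ?thesis
      using j by (simp add: dvec_True)
  qed
  then show d: "dirs E ?y = {(i, \<not> s)}"
    using dirs_eq_singleton[OF opp] by blast
  show "\<not> centre E ?y"
  proof
    assume "centre E ?y"
    then obtain j where j: "(?y, j) \<in> E" "deg E (?y + axis j 1) \<le> 1"
      using * by (auto simp: centre_def)
    then have "(j, True) \<in> dirs E ?y"
      by simp
    then have "j = i" "\<not> s"
      using d by auto
    then have "deg E c \<le> 1"
      using j(2) by (simp add: dvec_False)
    then show False
      using * \<open>\<not> s\<close> by simp
  qed
qed

text \<open>A cube that is no centre has exactly one edge. If its other end were no centre either,
  the edge would be isolated, and then its lower end is a centre.\<close>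

lemma ex_centre:
  assumes "x \<in> R" and nc: "\<not> centre E x"
  shows "\<exists>c\<in>R. centre E c \<and> x \<in> cell E c"
proof -
  obtain i s where p: "(i, s) \<in> dirs E x"
    using covering[OF assms(1)] by auto
  let ?y = "x + dvec (i, s)"
  have le: "deg E x \<le> 1"
    using nc by (auto simp: centre_def)
  have "centre E ?y"
  proof (rule ccontr)
    assume "\<not> centre E ?y"
    then have le': "deg E ?y \<le> 1"
      by (auto simp: centre_def)
    show False
    proof (cases s)
      case True
      then show False
        using p le' nc by (auto simp: centre_def dvec_True)
    next
      case False
      then have "(?y, i) \<in> E" "?y + axis i 1 = x"
        using p by (simp_all add: dvec_False)
      then have "centre E ?y"
        unfolding centre_def using le by metis
      with \<open>\<not> centre E ?y\<close> show False ..
    qed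
  qed
  moreover have "x = ?y + dvec (i, \<not> s)"
    by (simp flip: uminus_dvec)
  then have "x \<in> cell E ?y"
    using dirs_opposite[OF p] unfolding mem_cell_iff by blast
  ultimately show ?thesis
    using dirs_closed[OF p] by blast
qed

text \<open>The only edge of a leaf points back to the centre, so a leaf determines its centre; and
  a centre is never a leaf of another centre.\<close>

lemma cell_disjoint:
  assumes c: "centre E c" "centre E c'" and x: "x \<in> cell E c" "x \<in> cell E c'"
  shows "c = c'"
proof -
  consider "x = c" | i s where "(i, s) \<in> dirs E c" "x = c + dvec (i, s)"
    using x(1) by (auto simp: mem_cell_iff)
  then show ?thesis
  proof cases
    case 1
    then show ?thesis
      using x(2) c leaf(2)[OF c(2)] by (auto simp: mem_cell_iff)
  next
    case 2
    note A = leaf[OF c(1) 2(1)]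
    then have "x \<noteq> c'"
      using c 2 by auto
    then obtain j t where B: "(j, t) \<in> dirs E c'" "x = c' + dvec (j, t)"
      using x(2) by (auto simp: mem_cell_iff)
    then have "{(i, \<not> s)} = {(j, \<not> t)}"
      using A(1) leaf(1)[OF c(2) B(1)] 2(2) by simp
    then have "c + dvec (i, s) = c' + dvec (i, s)"
      using 2 B by simp
    then show ?thesis by simp
  qed
qed

lemma partition_cells: "partition_on R (cell E ` {c\<in>R. centre E c})"
proof (rule partition_onI)
  show "\<Union> (cell E ` {c \<in> R. centre E c}) = R"
  proof (intro equalityI subsetI)
    fix x assume "x \<in> \<Union> (cell E ` {c \<in> R. centre E c})"
    then obtain c where "c \<in> R" "x \<in> cell E c"
      by blast
    then show "x \<in> R"
      using dirs_closed by (auto simp: mem_cell_iff)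
  next
    fix x assume x: "x \<in> R"
    show "x \<in> \<Union> (cell E ` {c \<in> R. centre E c})"
    proof (cases "centre E x")
      case True
      moreover have "x \<in> cell E x"
        by (simp add: mem_cell_iff)
      ultimately show ?thesis
        using x by blast
    next
      case False
      then show ?thesis
        using ex_centre[OF x] by blast
    qed
  qed
next
  fix p q assume "p \<in> cell E ` {c\<in>R. centre E c}" "q \<in> cell E ` {c\<in>R. centre E c}" "p \<noteq> q"
  then show "disjnt p q"
    using cell_disjoint by (auto simp: disjnt_def)
qed (auto simp: cell_def star_def)

text \<open>Needed for the output, a list of placed tiles in which none may occur twice.\<close>

lemma inj_on_cell: "inj_on (cell E) {c. centre E c}"
proof (rule inj_onI)
  fix c c' assume "c \<in> {c. centre E c}" "c' \<in> {c. centre E c}" "cell E c = cell E c'"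
  moreover have "c \<in> cell E c"
    by (simp add: mem_cell_iff)
  ultimately show "c = c'"
    by (intro cell_disjoint[of c c' c]) auto
qed

end

text \<open>The neighbour is the first step of a path from \<open>c\<close> to any other
  cube.\<close>

lemma polyomino_neighbour:
  assumes R: "polyomino R" "\<not> is_singleton R" and c: "c \<in> R"
  shows "\<exists>p. c + dvec p \<in> R"
proof -
  have "R \<noteq> {c}"
    using R(2) by (auto simp: is_singleton_def)
  then obtain b where b: "b \<in> R" "b \<noteq> c"
    using c by blast
  then have "(\<lambda>x y. x \<in> R \<and> y \<in> R \<and> face_adjacent x y)\<^sup>*\<^sup>* c b"
    using R(1) c by (auto simp: polyomino_def)
  then show ?thesis
    using b(2) by (cases rule: converse_rtranclpE) (auto simp: face_adjacent_iff)
qed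

lemma dirs_adjacencies_nonempty:
  assumes R: "polyomino R" "\<not> is_singleton R" and c: "c \<in> R"
  shows "dirs (adjacencies R) c \<noteq> {}"
proof -
  obtain i s where "c + dvec (i, s) \<in> R"
    using polyomino_neighbour[OF assms] by auto
  then have "(i, s) \<in> dirs (adjacencies R) c"
    using c by (cases s) (auto simp: adjacencies_def dvec_True dvec_False)
  then show ?thesis by blast
qed

lemma star_graph_fold_prune:
  assumes "polyomino R" "\<not> is_singleton R" and "adjacencies R \<subseteq> set es"
  shows "star_graph (fold prune es (adjacencies R)) R"
  using assms fold_prune_subset
  by unfold_locales
    (auto simp: starry_fold_prune dirs_fold_prune_nonempty dirs_adjacencies_nonempty)

text \<open>The values of a coordinate on a polyomino form an interval.\<close>

lemma polyomino_coordinate_diff: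
  fixes R :: "(int ^ 'n::finite) set"
  assumes R: "polyomino R" and ab: "a \<in> R" "b \<in> R"
  shows "\<bar>a $ i - b $ i\<bar> < int (card R)"
proof -
  have fin: "finite R"
    using R by (simp add: polyomino_def)
  have "(\<lambda>x y. x \<in> R \<and> y \<in> R \<and> face_adjacent x y)\<^sup>*\<^sup>* a b"
    using R ab by (auto simp: polyomino_def)
  then have "{min (a $ i) (b $ i)..max (a $ i) (b $ i)} \<subseteq> (\<lambda>c. c $ i) ` R"
  proof (induction rule: rtranclp_induct)
    case base
    then show ?case
      using ab by auto
  next
    case (step y z)
    obtain j s where z: "z = y + dvec (j, s)"
      using step.hyps(2) by (auto simp: face_adjacent_iff)
    then have "\<bar>z $ i - y $ i\<bar> \<le> 1"
      by (auto simp: dvec_component)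
    then have "{min (a $ i) (z $ i)..max (a $ i) (z $ i)} \<subseteq>
        insert (z $ i) {min (a $ i) (y $ i)..max (a $ i) (y $ i)}"
      by auto
    then show ?case
      using step by auto
  qed
  then have "card {min (a $ i) (b $ i)..max (a $ i) (b $ i)} \<le> card ((\<lambda>c. c $ i) ` R)"
    using fin by (intro card_mono) auto
  also have "\<dots> \<le> card R"
    using fin by (rule card_image_le)
  finally show ?thesis
    by auto
qed

section \<open>Addresses\<close>

lemma sum_num: "(\<Sum>j<CARD('n). f j) = (\<Sum>i\<in>UNIV. f (num (i :: 'n::finite)))"
  by (rule sum.reindex_bij_betw[OF bij_num, symmetric])

lemma digits_unique:
  fixes b :: int
  assumes "\<forall>j<m. 0 \<le> u j \<and> u j < b \<and> 0 \<le> v j \<and> v j < b"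
    and "(\<Sum>j<m. u j * b ^ j) = (\<Sum>j<m. v j * b ^ j)"
  shows "\<forall>j<m. u j = v j"
  using assms
proof (induction m arbitrary: u v)
  case (Suc m)
  have split: "(\<Sum>j<Suc m. w j * b ^ j) = w 0 + b * (\<Sum>j<m. w (Suc j) * b ^ j)" for w
    by (subst sum.lessThan_Suc_shift) (simp add: sum_distrib_left mult_ac)
  have eq: "u 0 + b * (\<Sum>j<m. u (Suc j) * b ^ j) = v 0 + b * (\<Sum>j<m. v (Suc j) * b ^ j)"
    using Suc.prems(2) unfolding split .
  have b: "0 \<le> u 0" "u 0 < b" "0 \<le> v 0" "v 0 < b"
    using Suc.prems(1) by auto
  have "u 0 = (u 0 + b * (\<Sum>j<m. u (Suc j) * b ^ j)) mod b"
    using b by simp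
  also have "\<dots> = v 0"
    unfolding eq using b by simp
  finally have 0: "u 0 = v 0" .
  then have "(\<Sum>j<m. u (Suc j) * b ^ j) = (\<Sum>j<m. v (Suc j) * b ^ j)"
    using eq b by simp
  then have "\<forall>j<m. u (Suc j) = v (Suc j)"
    using Suc.prems(1) by (intro Suc.IH) auto
  with 0 show ?case
    by (metis less_Suc_eq_0_disj)
qed simp

definition radix :: "(int ^ 'n::finite) list \<Rightarrow> int" where
  "radix xs = 2 * int (length xs) + 1"

definition weight :: "(int ^ 'n::finite) list \<Rightarrow> nat \<Rightarrow> int" where
  "weight xs j = int (CARD('n) + 1) * radix xs ^ j"

text \<open>Coordinates are measured from the first cube of the input, from which every cube differs
  by less than n in each coordinate. Adding n puts the digits of cubes between 1 and 2n - 1, and the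
  values 0 and 2n are left for neighbours outside; hence the radix 2n + 1.\<close>

definition digit :: "(int ^ 'n::finite) list \<Rightarrow> int ^ 'n \<Rightarrow> 'n \<Rightarrow> int" where
  "digit xs c i = c $ i - hd xs $ i + int (length xs)"

text \<open>
  The cube \<open>c\<close> owns the cells \<open>addr xs c + f\<close> for \<open>0 \<le> f \<le> d\<close>: cell 0 tells whether the cube is present
  and cell \<open>1 + j\<close> whether the edge in the positive direction of axis \<open>j\<close> is. These addresses are
  negative, so that they do not interfere with the input, the tables and the output.
\<close>

definition addr :: "(int ^ 'n::finite) list \<Rightarrow> int ^ 'n \<Rightarrow> int" where
  "addr xs c = - int (CARD('n) + 1) - (\<Sum>i\<in>UNIV. digit xs c i * weight xs (num i))"

text \<open>These positions have valid digits, so addresses are injective on them. They include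
  absent positions next to the polyomino, whose cells the program also reads.\<close>

definition near :: "(int ^ 'n::finite) list \<Rightarrow> int ^ 'n \<Rightarrow> bool" where
  "near xs c \<longleftrightarrow> (\<forall>i. 0 \<le> digit xs c i \<and> digit xs c i < radix xs)"

definition proper_input :: "(int ^ 'n::finite) list \<Rightarrow> bool" where
  "proper_input xs \<longleftrightarrow> distinct xs \<and> polyomino (set xs) \<and> \<not> is_singleton (set xs)"

lemma proper_input_nonempty: "proper_input xs \<Longrightarrow> 0 < length xs"
  by (auto simp: proper_input_def polyomino_def)

lemma radix_pos [simp]: "0 < radix xs" "0 \<le> radix xs"
  by (simp_all add: radix_def)

lemma weight_pos [simp]: "0 < weight xs j" "0 \<le> weight xs j"
  by (simp_all add: weight_def)

lemma addr_nonneg: "near xs c \<Longrightarrow> addr xs c \<le> - int (CARD('n::finite) + 1)"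
  for c :: "int ^ 'n"
  unfolding addr_def near_def by (simp add: sum_nonneg)

text \<open>With K = d + 1 the cells have the form - K - K S + f, where S is the number with the
  given digits and 0 \<le> f < K. Reduction modulo K recovers f, and then S determines the
  digits.\<close>

lemma addr_inj:
  fixes c c' :: "int ^ 'n::finite"
  assumes near: "near xs c" "near xs c'"
    and f: "0 \<le> f" "f \<le> int CARD('n)" "0 \<le> f'" "f' \<le> int CARD('n)"
    and eq: "addr xs c + f = addr xs c' + f'"
  shows "c = c' \<and> f = f'"
proof -
  define u where "u c j = digit xs c (from_nat_into UNIV j)" for c :: "int ^ 'n" and j
  define S where "S c = (\<Sum>j<CARD('n). u c j * radix xs ^ j)" for c :: "int ^ 'n"
  define K where "K = int (CARD('n) + 1)"
  have S: "S c = (\<Sum>i\<in>UNIV. digit xs c i * radix xs ^ num i)" for c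
    unfolding S_def sum_num by (simp add: u_def)
  have addr: "addr xs c = - K - K * S c" for c
    by (simp add: addr_def S K_def weight_def sum_distrib_left mult_ac)
  have eq': "f + K * S c' = f' + K * S c"
    using eq unfolding addr by simp
  have "f = (f + K * S c') mod K"
    using f by (simp add: K_def)
  also have "\<dots> = f'"
    unfolding eq' using f by (simp add: K_def)
  finally have ff: "f = f'" .
  then have "S c = S c'"
    using eq' by (simp add: K_def)
  then have "\<forall>j<CARD('n). u c j = u c' j"
    using near unfolding S_def by (intro digits_unique) (auto simp: near_def u_def)
  then have "digit xs c i = digit xs c' i" for i
    using num_less[of i] by (metis UNIV_I countable_finite finite from_nat_into_to_nat_on u_def)
  then have "c = c'"
    by (simp add: digit_def vec_eq_iff)
  with ff show ?thesis by simp
qed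

lemma digit_add_axis: "digit xs (c + axis i k) j = digit xs c j + (if j = i then k else 0)"
  by (simp add: digit_def axis_def)

lemma digit_diff_axis: "digit xs (c - axis i k) j = digit xs c j - (if j = i then k else 0)"
  by (simp add: digit_def axis_def)

lemma addr_add_axis: "addr xs (c + axis i 1) = addr xs c - weight xs (num i)"
proof -
  have "(\<Sum>j\<in>UNIV. digit xs (c + axis i 1) j * weight xs (num j))
      = (\<Sum>j\<in>UNIV. digit xs c j * weight xs (num j) + (if j = i then weight xs (num i) else 0))"
    by (intro sum.cong) (auto simp: digit_add_axis distrib_right)
  then show ?thesis
    by (simp add: addr_def sum.distrib)
qed

lemma addr_diff_axis: "addr xs (c - axis i 1) = addr xs c + weight xs (num i)"
  using addr_add_axis[of xs "c - axis i 1" i] by simp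

lemma digit_mem:
  assumes "proper_input xs" and "c \<in> set xs"
  shows "0 < digit xs c i \<and> digit xs c i < radix xs - 1"
proof -
  have "hd xs \<in> set xs"
    using assms by (intro hd_in_set) auto
  moreover have "card (set xs) = length xs"
    using assms by (simp add: proper_input_def distinct_card)
  ultimately have "\<bar>c $ i - hd xs $ i\<bar> < int (length xs)"
    using polyomino_coordinate_diff[of "set xs" c "hd xs" i] assms by (simp add: proper_input_def)
  then show ?thesis
    by (auto simp: digit_def radix_def)
qed

text \<open>The last form is needed for the degree of an upper neighbour, whose downward edges are
  stored with the cubes below it.\<close>

lemma near_mem:
  assumes "proper_input xs" and "c \<in> set xs"
  shows "near xs c" "near xs (c + axis i 1)" "near xs (c - axis i 1)"
    "near xs (c + axis i 1 - axis j 1)"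
proof -
  have "0 < digit xs c k" "digit xs c k < radix xs - 1" for k
    using digit_mem[OF assms] by auto
  then have "0 \<le> digit xs c k" "digit xs c k < radix xs" "0 \<le> digit xs c k - 1"
    "digit xs c k + 1 < radix xs" for k
    by (smt (verit))+
  then show "near xs c" "near xs (c + axis i 1)" "near xs (c - axis i 1)"
    "near xs (c + axis i 1 - axis j 1)"
    by (auto simp: near_def digit_add_axis digit_diff_axis) (smt (verit))+
qed


section \<open>Scanning the cubes\<close>

text \<open>The tables follow the input. For \<open>j = CARD('n)\<close> this is the end of the last
  one, where the output begins.\<close>

definition table_start :: "(int ^ 'n::finite) list \<Rightarrow> nat \<Rightarrow> int" where
  "table_start xs j = int (length xs * CARD('n)) + int j * radix xs"

definition input_cells :: "(int ^ 'n::finite) list \<Rightarrow> (int \<Rightarrow> int) \<Rightarrow> bool" where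
  "input_cells xs \<mu> \<longleftrightarrow> (\<forall>k<length xs. \<forall>i. \<mu> (int (k * CARD('n)) + int (num i)) = xs ! k $ i)"

text \<open>The tables replace the multiplications by weights, which the machine does not offer.\<close>

definition table_cells :: "(int ^ 'n::finite) list \<Rightarrow> nat \<Rightarrow> ram_state \<Rightarrow> bool" where
  "table_cells xs k s \<longleftrightarrow> (\<forall>i :: 'n. num i < k \<longrightarrow>
     fst s (weight_reg (num i)) = weight xs (num i) \<and>
     fst s (table_reg (num i)) = table_start xs (num i) - hd xs $ i + int (length xs) \<and>
     (\<forall>u. 0 \<le> u \<longrightarrow> u < radix xs \<longrightarrow> snd s (table_start xs (num i) + u) = u * weight xs (num i)))"

text \<open>What all phases after the setup preserve. It says nothing about the negative cells,
  which hold the graph, nor about the cells from the start of the output on.\<close>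

definition base :: "(int ^ 'n::finite) list \<Rightarrow> ram_state \<Rightarrow> bool" where
  "base xs s \<longleftrightarrow> proper_input xs \<and> fst s 0 = int (length xs) \<and>
     fst s 1 = table_start xs CARD('n) \<and> input_cells xs (snd s) \<and> table_cells xs CARD('n) s"

lemma input_address:
  assumes "k < length (xs :: (int ^ 'n::finite) list)"
  shows "int (k * CARD('n)) + int (num (i :: 'n)) < int (length xs * CARD('n))"
proof -
  have "k * CARD('n) + num i < Suc k * CARD('n)"
    by simp
  also have "\<dots> \<le> length xs * CARD('n)"
    using assms by (intro mult_le_mono1) simp
  finally show ?thesis
    by linarith
qed

lemma table_start_mono: "j \<le> k \<Longrightarrow> table_start xs j \<le> table_start xs k"
  by (simp add: table_start_def mult_right_mono)

lemma table_start_ge: "int (length xs * CARD('n)) \<le> table_start xs j"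
  for xs :: "(int ^ 'n::finite) list"
  by (simp add: table_start_def)

lemma table_start_nonneg: "0 \<le> table_start xs j"
  by (simp add: table_start_def)

lemma table_address:
  assumes "j < k" and "u < radix xs"
  shows "table_start xs j + u < table_start xs k"
proof -
  have "table_start xs j + u < table_start xs (Suc j)"
    using assms(2) by (simp add: table_start_def algebra_simps)
  also have "\<dots> \<le> table_start xs k"
    using assms(1) by (intro table_start_mono) simp
  finally show ?thesis .
qed

lemma input_cells_cong:
  assumes "input_cells xs \<mu>" and "\<And>a. 0 \<le> a \<Longrightarrow> a < table_start xs k \<Longrightarrow> \<mu>' a = \<mu> a"
  shows "input_cells xs \<mu>'"
  unfolding input_cells_def
proof (intro allI impI)
  fix l and i :: 'a assume l: "l < length xs"
  have "int (l * CARD('a)) + int (num i) < table_start xs k"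
    using less_le_trans[OF input_address[OF l, of i] table_start_ge[of xs k]] .
  then have "\<mu>' (int (l * CARD('a)) + int (num i)) = \<mu> (int (l * CARD('a)) + int (num i))"
    by (intro assms(2)) simp_all
  then show "\<mu>' (int (l * CARD('a)) + int (num i)) = xs ! l $ i"
    using assms(1) l by (simp add: input_cells_def)
qed

lemma table_cells_cong:
  assumes "table_cells xs k s"
    and "\<And>j. j < k \<Longrightarrow> fst s' (weight_reg j) = fst s (weight_reg j)"
    and "\<And>j. j < k \<Longrightarrow> fst s' (table_reg j) = fst s (table_reg j)"
    and "\<And>a. 0 \<le> a \<Longrightarrow> a < table_start xs k \<Longrightarrow> snd s' a = snd s a"
  shows "table_cells xs k s'"
  unfolding table_cells_def
proof (intro allI impI conjI)
  fix i :: 'a assume i: "num i < k"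
  show "fst s' (weight_reg (num i)) = weight xs (num i)"
    "fst s' (table_reg (num i)) = table_start xs (num i) - hd xs $ i + int (length xs)"
    using assms(1-3) i unfolding table_cells_def by auto
  fix u assume u: "0 \<le> u" "u < radix xs"
  have "0 \<le> table_start xs (num i) + u" "table_start xs (num i) + u < table_start xs k"
    using u i table_address table_start_nonneg[of xs "num i"] by auto
  then show "snd s' (table_start xs (num i) + u) = u * weight xs (num i)"
    using assms(1,4) u i unfolding table_cells_def by auto
qed

lemma base_cong:
  fixes xs :: "(int ^ 'n::finite) list"
  assumes "base xs s" and "\<And>r. r < 2 \<or> 20 \<le> r \<Longrightarrow> fst s' r = fst s r"
    and "\<And>a. 0 \<le> a \<Longrightarrow> a < table_start xs CARD('n) \<Longrightarrow> snd s' a = snd s a"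
  shows "base xs s'"
proof -
  have "input_cells xs (snd s')"
    using input_cells_cong[of xs "snd s" "CARD('n)" "snd s'"] assms(1,3) by (simp add: base_def)
  moreover have "table_cells xs CARD('n) s'"
  proof (rule table_cells_cong)
    show "table_cells xs CARD('n) s"
      using assms(1) by (simp add: base_def)
  qed (simp_all add: assms(2,3) weight_reg_def table_reg_def)
  ultimately show ?thesis
    using assms(1) by (simp add: base_def assms(2))
qed

lemma hash_correct:
  fixes xs :: "(int ^ 'n::finite) list"
  assumes "base xs s" and "fst s 6 = int (k * CARD('n))" and k: "k < length xs"
  shows "fst (sem (hash_prog CARD('n)) s) 5 = addr xs (xs ! k)"
proof -
  have "snd s (fst s (table_reg (num i)) + snd s (fst s 6 + int (num i)))
      = digit xs (xs ! k) i * weight xs (num i)" for i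
  proof -
    have in_cells: "snd s (fst s 6 + int (num i)) = xs ! k $ i"
      using assms unfolding base_def input_cells_def by simp
    have mem: "xs ! k \<in> set xs" and good: "proper_input xs"
      using assms by (auto simp: base_def)
    have "fst s (table_reg (num i)) = table_start xs (num i) - hd xs $ i + int (length xs)"
      and tab: "\<And>u. 0 \<le> u \<Longrightarrow> u < radix xs \<Longrightarrow>
        snd s (table_start xs (num i) + u) = u * weight xs (num i)"
      using assms(1) num_less[of i] unfolding base_def table_cells_def by blast+
    then have "fst s (table_reg (num i)) + xs ! k $ i = table_start xs (num i) + digit xs (xs ! k) i"
      by (simp add: digit_def)
    then show ?thesis
      unfolding in_cells using digit_mem[OF good mem, of i] tab[of "digit xs (xs ! k) i"] by simp
  qed
  then show ?thesis
    unfolding sem_hash_prog sum_num by (simp add: addr_def)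
qed

definition scan :: "nat \<Rightarrow> ram_prog \<Rightarrow> ram_prog" where
  "scan d p = Seq (Seq (Const 6 0) (Seq (Const 2 0) (Add 7 0 2)))
     (repeat 7 (Seq (hash_prog d) (Seq p (Seq (Const 2 (int d)) (Add 6 6 2)))))"

text \<open>The common rule for all passes over the cubes. Registers 5 and 6 locate the current cube
  when \<open>p\<close> starts. The invariant \<open>J\<close> may not depend on the registers used
  by the scan itself, and \<open>p\<close> has to leave input, tables and the registers of
  \<open>base\<close> alone.\<close>

lemma lin_scan:
  fixes J :: "(int ^ 'n::finite) list \<Rightarrow> nat \<Rightarrow> ram_state \<Rightarrow> bool"
  assumes p: "loop_free p" "writes p \<subseteq> {2..<20} - {6, 7}"
    and J: "\<And>xs k s \<rho>. J xs k s \<Longrightarrow> (\<And>r. r \<notin> {2, 3, 5, 6, 7} \<Longrightarrow> \<rho> r = fst s r) \<Longrightarrow> J xs k (\<rho>, snd s)"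
    and step: "\<And>xs k s. k < length xs \<Longrightarrow> base xs s \<Longrightarrow> J xs k s \<Longrightarrow> fst s 6 = int (k * CARD('n)) \<Longrightarrow>
      fst s 5 = addr xs (xs ! k) \<Longrightarrow> J xs (Suc k) (sem p s)"
    and mem: "\<And>xs k s a. k < length xs \<Longrightarrow> base xs s \<Longrightarrow> J xs k s \<Longrightarrow> fst s 6 = int (k * CARD('n)) \<Longrightarrow>
      fst s 5 = addr xs (xs ! k) \<Longrightarrow> 0 \<le> a \<Longrightarrow> a < table_start xs CARD('n) \<Longrightarrow> snd (sem p s) a = snd s a"
  shows "lin length (\<lambda>xs s. base xs s \<and> J xs 0 s) (scan CARD('n) p)
    (\<lambda>xs s. base xs s \<and> J xs (length xs) s)"
proof -
  define I where "I xs k s \<longleftrightarrow> base xs s \<and> J xs k s \<and> fst s 6 = int (k * CARD('n))"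
    for xs :: "(int ^ 'n) list" and k s
  have I_cong: "I xs k (\<rho>, snd s)"
    if "I xs k s" "\<And>r. r \<notin> {2, 3, 5, 7} \<Longrightarrow> \<rho> r = fst s r" for xs k s \<rho>
    using that unfolding I_def by (auto intro!: J base_cong[of xs s])
  let ?b = "Seq (hash_prog CARD('n)) (Seq p (Seq (Const 2 (int CARD('n))) (Add 6 6 2)))"
  have notin: "7 \<notin> writes p" "6 \<notin> writes p"
    using p(2) by auto
  have wh: "r \<notin> writes (hash_prog CARD('n))" if "r \<notin> {2, 3, 5}" for r
    using hash_prog_simps(2) that by blast
  have "lin length (\<lambda>xs s. I xs 0 s \<and> fst s 7 = int (length xs)) (repeat 7 ?b) (\<lambda>xs. I xs (length xs))"
  proof (rule lin_repeat)
    show "loop_free ?b"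
      using p by simp
    show "7 \<notin> writes ?b"
      using notin wh by simp
    show "0 < length xs \<and> length xs \<le> 1 * length xs" if "I xs 0 s" for xs s
      using that proper_input_nonempty by (auto simp: I_def base_def)
  next
    fix xs k s \<rho>
    assume k: "k < length xs" and Is: "I xs k s"
      and \<rho>: "\<And>q. q \<noteq> 2 \<Longrightarrow> q \<noteq> 7 \<Longrightarrow> \<rho> q = fst (sem ?b s) q"
    define s1 where "s1 = sem (hash_prog CARD('n)) s"
    have s1: "s1 = (fst s1, snd s)"
      unfolding s1_def by (metis hash_prog_simps(3) prod.collapse sem_no_store)
    have r1: "fst s1 r = fst s r" if "r \<notin> {2, 3, 5}" for r
      unfolding s1_def using wh[OF that] by (rule sem_frame)
    have I1: "I xs k s1"
      using r1 by (subst s1) (intro I_cong[OF Is], auto)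
    have h: "fst s1 5 = addr xs (xs ! k)"
      unfolding s1_def using Is k by (intro hash_correct) (auto simp: I_def)
    define s2 where "s2 = sem p s1"
    have J2: "J xs (Suc k) s2"
      unfolding s2_def using I1 h k by (intro step) (auto simp: I_def)
    have r2: "fst s2 r = fst s1 r" if "r \<notin> {2..<20} - {6, 7}" for r
      unfolding s2_def using p(2) that by (intro sem_frame) auto
    have B2: "base xs s2"
    proof (rule base_cong)
      show "base xs s1"
        using I1 by (simp add: I_def)
      show "fst s2 r = fst s1 r" if "r < 2 \<or> 20 \<le> r" for r
        using that by (intro r2) auto
      show "snd s2 a = snd s1 a" if "0 \<le> a" "a < table_start xs CARD('n)" for a
        unfolding s2_def using I1 h k that by (intro mem) (auto simp: I_def)
    qed
    have s3: "sem ?b s = ((fst s2)(2 := int CARD('n), 6 := fst s2 6 + int CARD('n)), snd s2)"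
      by (simp add: s1_def s2_def)
    have "base xs (\<rho>, snd (sem ?b s))"
      using \<rho> unfolding s3 by (intro base_cong[OF B2]) auto
    moreover have "J xs (Suc k) (\<rho>, snd (sem ?b s))"
      using \<rho> unfolding s3 by simp (rule J[OF J2], auto)
    moreover have "\<rho> 6 = int (Suc k * CARD('n))"
      using \<rho>[of 6] r2[of 6] I1 unfolding s3 I_def by simp
    ultimately show "I xs (Suc k) (\<rho>, snd (sem ?b s))"
      by (simp add: I_def)
  qed simp
  moreover have "lin length (\<lambda>xs s. base xs s \<and> J xs 0 s) (Seq (Const 6 0) (Seq (Const 2 0) (Add 7 0 2)))
      (\<lambda>xs s. I xs 0 s \<and> fst s 7 = int (length xs))"
  proof (rule lin_loop_free)
    fix xs s assume A: "base xs s \<and> J xs 0 s"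
    define s' where "s' = sem (Seq (Const 6 0) (Seq (Const 2 0) (Add 7 0 2))) s"
    have s': "s' = ((fst s)(6 := 0, 2 := 0, 7 := fst s 0), snd s)"
      by (simp add: s'_def)
    have "base xs s'"
      using A by (rule base_cong[OF conjunct1]) (auto simp: s')
    moreover have "J xs 0 s'"
      unfolding s' using A by (rule J[OF conjunct2]) simp_all
    moreover have "0 < length xs" "fst s' 7 = int (length xs)"
      using A proper_input_nonempty by (auto simp: base_def s')
    ultimately show "0 < length xs \<and> I xs 0 s' \<and> fst s' 7 = int (length xs)"
      by (simp add: I_def s')
  qed simp
  ultimately have "lin length (\<lambda>xs s. base xs s \<and> J xs 0 s) (scan CARD('n) p) (\<lambda>xs. I xs (length xs))"
    unfolding scan_def by (rule lin_Seq[rotated])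
  then show ?thesis
    by (rule lin_mono) (auto simp: I_def)
qed

section \<open>Building the tables\<close>

text \<open>On entry register 13 holds the weight of axis \<open>j\<close>. Cell \<open>j\<close> of
  the input is coordinate \<open>j\<close> of the first cube, and subtracting it and adding n shifts
  the table so that raw coordinates index it.\<close>

definition table_init :: "nat \<Rightarrow> ram_prog" where
  "table_init j = seqs [Const 2 0, Add (weight_reg j) 13 2, Const 3 (int j), Load 2 3,
     Sub (table_reg j) 8 2, Add (table_reg j) (table_reg j) 0, Const 13 0, Const 2 0, Add 7 10 2]"

definition table_step :: "nat \<Rightarrow> ram_prog" where
  "table_step j = seqs [Store 8 13, Add 13 13 (weight_reg j), Const 2 1, Add 8 8 2]"

definition table_prog :: "nat \<Rightarrow> ram_prog" where
  "table_prog j = Seq (table_init j) (repeat 7 (table_step j))"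

definition setup_init :: "nat \<Rightarrow> ram_prog" where
  "setup_init d = seqs [Const 2 1, Add 10 0 0, Add 10 10 2, Const 8 0,
     seqs (replicate d (Add 8 8 0)), Const 13 (int (d + 1))]"

definition setup_prog :: "nat \<Rightarrow> ram_prog" where
  "setup_prog d = Seq (setup_init d) (Seq (seqs (map table_prog [0..<d])) (seqs [Const 2 0, Add 1 8 2]))"

text \<open>The zeros at negative addresses are carried along because they later serve as the graph
  without cubes and edges.\<close>

definition setup_inv :: "nat \<Rightarrow> (int ^ 'n::finite) list \<Rightarrow> ram_state \<Rightarrow> bool" where
  "setup_inv j xs s \<longleftrightarrow> proper_input xs \<and> fst s 0 = int (length xs) \<and> fst s 10 = radix xs \<and>
     fst s 8 = table_start xs j \<and> fst s 13 = weight xs j \<and> input_cells xs (snd s) \<and>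
     table_cells xs j s \<and> (\<forall>a<0. snd s a = 0)"

definition table_inv :: "nat \<Rightarrow> (int ^ 'n::finite) list \<Rightarrow> nat \<Rightarrow> ram_state \<Rightarrow> bool" where
  "table_inv j xs u s \<longleftrightarrow> proper_input xs \<and> fst s 0 = int (length xs) \<and> fst s 10 = radix xs \<and>
     fst s 8 = table_start xs j + int u \<and> fst s 13 = int u * weight xs j \<and>
     fst s (weight_reg j) = weight xs j \<and>
     fst s (table_reg j) = table_start xs j - hd xs $ from_nat_into UNIV j + int (length xs) \<and>
     input_cells xs (snd s) \<and> table_cells xs j s \<and> (\<forall>a<0. snd s a = 0) \<and>
     (\<forall>v. 0 \<le> v \<longrightarrow> v < int u \<longrightarrow> snd s (table_start xs j + v) = v * weight xs j)"

lemma weight_Suc: "weight xs (Suc j) = radix xs * weight xs j"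
  by (simp add: weight_def)

lemma table_start_Suc: "table_start xs (Suc j) = table_start xs j + radix xs"
  by (simp add: table_start_def algebra_simps)

lemma num_from_nat_into: "j < CARD('n) \<Longrightarrow> num (from_nat_into (UNIV :: 'n::finite set) j) = j"
  by (metis UNIV_I countable_finite ex_num finite from_nat_into_to_nat_on)

lemma from_nat_into_num: "from_nat_into UNIV (num (i :: 'n::finite)) = i"
  by (simp add: countable_finite)

lemma lin_table_init:
  assumes "j < CARD('n)"
  shows "lin length (setup_inv j) (table_init j)
    (\<lambda>xs s. table_inv j (xs :: (int ^ 'n::finite) list) 0 s \<and> fst s 7 = int (nat (radix xs)))"
proof (rule lin_loop_free)
  show "loop_free (table_init j)"
    by (simp add: table_init_def)
  fix xs :: "(int ^ 'n) list" and s assume P: "setup_inv j xs s"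
  then have pos: "0 < length xs"
    using proper_input_nonempty by (auto simp: setup_inv_def)
  have hd: "snd s (int j) = hd xs $ from_nat_into UNIV j"
  proof -
    have "snd s (int (0 * CARD('n)) + int (num (from_nat_into (UNIV :: 'n set) j)))
        = xs ! 0 $ from_nat_into UNIV j"
      using P pos unfolding setup_inv_def input_cells_def by blast
    then show ?thesis
      using assms pos by (simp add: num_from_nat_into hd_conv_nth)
  qed
  have "table_cells xs j (sem (table_init j) s)"
  proof (rule table_cells_cong)
    show "table_cells xs j s"
      using P by (simp add: setup_inv_def)
  qed (simp_all add: table_init_def)
  then show "0 < length xs \<and> table_inv j xs 0 (sem (table_init j) s) \<and>
      fst (sem (table_init j) s) 7 = int (nat (radix xs))"
    using P pos hd unfolding setup_inv_def table_inv_def by (simp add: table_init_def)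
qed

lemma table_inv_step:
  fixes xs :: "(int ^ 'n::finite) list"
  assumes "table_inv j xs u s" and "int u < radix xs"
    and \<rho>: "\<And>q. q \<noteq> 2 \<Longrightarrow> q \<noteq> 7 \<Longrightarrow> \<rho> q = fst (sem (table_step j) s) q"
  shows "table_inv j xs (Suc u) (\<rho>, snd (sem (table_step j) s))"
proof -
  let ?b = "table_start xs j"
  have old: "snd (sem (table_step j) s) a = snd s a" if "a < ?b + int u" for a
    using assms(1) that by (simp add: table_step_def table_inv_def)
  have new: "snd (sem (table_step j) s) (?b + int u) = int u * weight xs j"
    using assms(1) by (simp add: table_step_def table_inv_def)
  have regs: "\<rho> 8 = ?b + int (Suc u)" "\<rho> 13 = int (Suc u) * weight xs j"
    using assms(1) by (simp_all add: \<rho> table_step_def table_inv_def distrib_right)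
  have same: "\<rho> q = fst s q" if "q \<notin> {2, 7, 8, 13}" for q
    using that by (simp add: \<rho> table_step_def)
  have "input_cells xs (snd (sem (table_step j) s))"
  proof (rule input_cells_cong[where k = j])
    show "input_cells xs (snd s)"
      using assms(1) by (simp add: table_inv_def)
  qed (simp add: old)
  moreover have "table_cells xs j (\<rho>, snd (sem (table_step j) s))"
  proof (rule table_cells_cong)
    show "table_cells xs j s"
      using assms(1) by (simp add: table_inv_def)
  qed (simp_all add: old same)
  moreover have "snd (sem (table_step j) s) (?b + v) = v * weight xs j" if "0 \<le> v" "v < int (Suc u)" for v
  proof (cases "v = int u")
    case False
    then show ?thesis
      using that assms(1) old[of "?b + v"] by (simp add: table_inv_def)
  qed (use new in simp)
  moreover have "snd (sem (table_step j) s) a = 0" if "a < 0" for a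
    using that assms(1) old[of a] table_start_nonneg[of xs j] by (simp add: table_inv_def)
  ultimately show ?thesis
    using assms(1) regs unfolding table_inv_def by (simp add: same)
qed

lemma table_inv_final:
  fixes xs :: "(int ^ 'n::finite) list"
  assumes "j < CARD('n)" and "table_inv j xs (nat (radix xs)) s"
  shows "setup_inv (Suc j) xs s"
proof -
  have "table_cells xs (Suc j) s"
    unfolding table_cells_def
  proof (intro allI impI)
    fix i :: 'n assume "num i < Suc j"
    then consider "num i < j" | "num i = j" "i = from_nat_into UNIV j"
      by (metis from_nat_into_num less_Suc_eq)
    then show "fst s (weight_reg (num i)) = weight xs (num i) \<and>
      fst s (table_reg (num i)) = table_start xs (num i) - hd xs $ i + int (length xs) \<and>
      (\<forall>u. 0 \<le> u \<longrightarrow> u < radix xs \<longrightarrow> snd s (table_start xs (num i) + u) = u * weight xs (num i))"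
    proof cases
      case 1
      then show ?thesis
        using assms(2) unfolding table_inv_def table_cells_def by blast
    next
      case 2
      then show ?thesis
        using assms unfolding table_inv_def by (simp add: num_from_nat_into)
    qed
  qed
  then show ?thesis
    using assms(2) by (simp add: table_inv_def setup_inv_def weight_Suc table_start_Suc)
qed

lemma lin_table_prog:
  assumes "j < CARD('n)"
  shows "lin length (setup_inv j) (table_prog j) (setup_inv (Suc j) :: (int ^ 'n::finite) list \<Rightarrow> _)"
proof -
  have "lin length (\<lambda>xs s. table_inv j (xs :: (int ^ 'n) list) 0 s \<and> fst s 7 = int (nat (radix xs)))
      (repeat 7 (table_step j)) (\<lambda>xs. table_inv j xs (nat (radix xs)))"
  proof (rule lin_repeat)
    \<comment> \<open>A table has 2n + 1 entries, at most 3n because n is positive.\<close>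
    show "0 < length xs \<and> nat (radix xs) \<le> 3 * length xs" if "table_inv j xs 0 s"
      for xs :: "(int ^ 'n) list" and s
    proof -
      have "0 < length xs"
        using that proper_input_nonempty by (auto simp: table_inv_def)
      then show ?thesis
        unfolding radix_def by linarith
    qed
    fix xs :: "(int ^ 'n) list" and u s \<rho>
    assume "u < nat (radix xs)" "table_inv j xs u s"
      "\<And>q. q \<noteq> 2 \<Longrightarrow> q \<noteq> 7 \<Longrightarrow> \<rho> q = fst (sem (table_step j) s) q"
    then show "table_inv j xs (Suc u) (\<rho>, snd (sem (table_step j) s))"
      by (intro table_inv_step) auto
  qed (simp_all add: table_step_def)
  then have "lin length (\<lambda>xs s. table_inv j (xs :: (int ^ 'n) list) 0 s \<and> fst s 7 = int (nat (radix xs)))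
      (repeat 7 (table_step j)) (setup_inv (Suc j))"
    by (rule lin_mono) (use table_inv_final[OF assms] in auto)
  with lin_table_init[OF assms] show ?thesis
    unfolding table_prog_def by (rule lin_Seq)
qed

lemma input_state_cells: "input_cells xs (snd (input_state xs))"
  unfolding input_cells_def
proof (intro allI impI)
  fix k and i :: 'a assume k: "k < length xs"
  have "nat (int (k * CARD('a)) + int (num i)) = k * CARD('a) + num i"
    by linarith
  moreover have "(k * CARD('a) + num i) div CARD('a) = k" "(k * CARD('a) + num i) mod CARD('a) = num i"
    by simp_all
  ultimately show "snd (input_state xs) (int (k * CARD('a)) + int (num i)) = xs ! k $ i"
    using input_address[OF k, of i] unfolding input_state_def by (simp add: from_nat_into_num)
qed

lemma sem_setup_init:
  "fst (sem (setup_init d) s) = (fst s)(2 := 0, 10 := 2 * fst s 0 + 1, 8 := int d * fst s 0, 13 := int (d + 1))"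
  "snd (sem (setup_init d) s) = snd s"
proof -
  have "sem (seqs (replicate d (Add 8 8 0))) s = ((fst s)(2 := 0, 8 := fst s 8 + int d * fst s 0), snd s)" for s
    by (induction d arbitrary: s) (auto simp: algebra_simps fun_eq_iff)
  then show "fst (sem (setup_init d) s) = (fst s)(2 := 0, 10 := 2 * fst s 0 + 1, 8 := int d * fst s 0, 13 := int (d + 1))"
    "snd (sem (setup_init d) s) = snd s"
    by (auto simp: setup_init_def fun_eq_iff)
qed

lemma loop_free_setup_init: "loop_free (setup_init d)"
  by (auto simp: setup_init_def)

lemma setup_inv_scratch:
  assumes "setup_inv j xs s"
  shows "setup_inv j xs ((fst s)(2 := 0), snd s)"
proof -
  have "table_cells xs j ((fst s)(2 := 0), snd s)"
  proof (rule table_cells_cong)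
    show "table_cells xs j s"
      using assms by (simp add: setup_inv_def)
  qed simp_all
  then show ?thesis
    using assms by (simp add: setup_inv_def)
qed

lemma lin_setup_prog:
  "lin length (\<lambda>xs s. proper_input xs \<and> s = input_state xs) (setup_prog CARD('n))
    (\<lambda>(xs :: (int ^ 'n::finite) list) s. base xs s \<and> (\<forall>a<0. snd s a = 0))"
  unfolding setup_prog_def
proof (intro lin_Seq)
  show "lin length (\<lambda>xs s. proper_input xs \<and> s = input_state xs) (setup_init CARD('n))
      (setup_inv 0 :: (int ^ 'n) list \<Rightarrow> _)"
  proof (rule lin_loop_free[OF loop_free_setup_init])
    fix xs :: "(int ^ 'n) list" and s
    assume A: "proper_input xs \<and> s = input_state xs"
    then have "fst s 0 = int (length xs)" "\<forall>a<0. snd s a = 0"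
      by (simp_all add: input_state_def)
    then show "0 < length xs \<and> setup_inv 0 xs (sem (setup_init CARD('n)) s)"
      using A proper_input_nonempty[of xs] input_state_cells[of xs]
      by (simp add: setup_inv_def sem_setup_init table_cells_def radix_def table_start_def weight_def)
  qed
  show "lin length (setup_inv 0 :: (int ^ 'n) list \<Rightarrow> _) (seqs (map table_prog [0..<CARD('n)]))
      (setup_inv CARD('n))"
  proof (rule lin_seqs[where P = setup_inv])
    fix xs :: "(int ^ 'n) list" and s
    assume "setup_inv (length (map table_prog [0..<CARD('n)])) xs s"
    then show "0 < length xs \<and> setup_inv CARD('n) xs ((fst s)(2 := 0), snd s)"
      using setup_inv_scratch[of "CARD('n)" xs s] proper_input_nonempty[of xs]
      by (simp add: setup_inv_def)
  qed (simp add: lin_table_prog)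
  show "lin length (setup_inv CARD('n)) (seqs [Const 2 0, Add 1 8 2])
      (\<lambda>(xs :: (int ^ 'n) list) s. base xs s \<and> (\<forall>a<0. snd s a = 0))"
  proof (rule lin_loop_free)
    fix xs :: "(int ^ 'n) list" and s
    assume P: "setup_inv CARD('n) xs s"
    have "table_cells xs CARD('n) (sem (seqs [Const 2 0, Add 1 8 2]) s)"
    proof (rule table_cells_cong)
      show "table_cells xs CARD('n) s"
        using P by (simp add: setup_inv_def)
    qed simp_all
    then show "0 < length xs \<and> base xs (sem (seqs [Const 2 0, Add 1 8 2]) s) \<and>
        (\<forall>a<0. snd (sem (seqs [Const 2 0, Add 1 8 2]) s) a = 0)"
      using P proper_input_nonempty[of xs] by (simp add: setup_inv_def base_def)
  qed simp
qed

section \<open>Building and pruning the adjacency graph in memory\<close>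

definition present :: "(int ^ 'n::finite) list \<Rightarrow> (int \<Rightarrow> int) \<Rightarrow> bool" where
  "present xs \<mu> \<longleftrightarrow> (\<forall>c. near xs c \<longrightarrow> \<mu> (addr xs c) = of_bool (c \<in> set xs))"

definition edge_addr :: "(int ^ 'n::finite) list \<Rightarrow> int ^ 'n \<Rightarrow> 'n \<Rightarrow> int" where
  "edge_addr xs c i = addr xs c + (1 + int (num i))"

text \<open>The condition extends to positions without a cube: their flags are read when degrees are
  computed and have to be 0.\<close>

definition encodes :: "(int ^ 'n::finite) list \<Rightarrow> (int \<Rightarrow> int) \<Rightarrow> 'n edge set \<Rightarrow> bool" where
  "encodes xs \<mu> E \<longleftrightarrow> (\<forall>c i. near xs c \<longrightarrow> \<mu> (edge_addr xs c i) = of_bool ((c, i) \<in> E))"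

lemma num_Suc_le: "1 + int (num (i :: 'n::finite)) \<le> int CARD('n)"
  using num_less[of i] by linarith

lemma addr_neq_edge_addr:
  fixes c c' :: "int ^ 'n::finite"
  assumes "near xs c" "near xs c'"
  shows "addr xs c \<noteq> edge_addr xs c' i"
proof
  assume "addr xs c = edge_addr xs c' i"
  then have "addr xs c + 0 = addr xs c' + (1 + int (num i))"
    by (simp add: edge_addr_def)
  then have "c = c' \<and> 0 = 1 + int (num i)"
    using num_Suc_le[of i] by (intro addr_inj[OF assms]) auto
  then show False by simp
qed

lemma edge_addr_eq_iff:
  fixes c c' :: "int ^ 'n::finite"
  assumes "near xs c" "near xs c'"
  shows "edge_addr xs c i = edge_addr xs c' j \<longleftrightarrow> c = c' \<and> i = j"
proof
  assume "edge_addr xs c i = edge_addr xs c' j"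
  then have "c = c' \<and> 1 + int (num i) = 1 + int (num j)"
    using num_Suc_le[of i] num_Suc_le[of j] unfolding edge_addr_def by (intro addr_inj[OF assms]) auto
  then show "c = c' \<and> i = j"
    by simp
qed simp

lemma addr_eq_iff: "near xs c \<Longrightarrow> near xs c' \<Longrightarrow> addr xs c = addr xs c' \<longleftrightarrow> c = c'"
  using addr_inj[of xs c c' 0 0] by auto

lemma addr_neg:
  fixes c :: "int ^ 'n::finite"
  assumes "near xs c"
  shows "addr xs c < 0" "edge_addr xs c i < 0"
  using addr_nonneg[OF assms] num_less[of i] unfolding edge_addr_def by linarith+

lemma present_update:
  assumes "present xs \<mu>" "near xs c"
  shows "present xs (\<mu>(edge_addr xs c i := v))"
  using assms addr_neq_edge_addr[OF _ assms(2)] unfolding present_def by auto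

lemma encodes_update:
  assumes "encodes xs \<mu> E" "near xs c"
  shows "encodes xs (\<mu>(edge_addr xs c i := of_bool b)) (if b then insert (c, i) E else E - {(c, i)})"
  unfolding encodes_def
proof (intro allI impI)
  fix c' j assume "near xs c'"
  then show "(\<mu>(edge_addr xs c i := of_bool b)) (edge_addr xs c' j) =
      of_bool ((c', j) \<in> (if b then insert (c, i) E else E - {(c, i)}))"
    using assms edge_addr_eq_iff[of xs c' c j i] by (auto simp: encodes_def)
qed

lemma base_weight:
  fixes xs :: "(int ^ 'n::finite) list"
  shows "base xs s \<Longrightarrow> fst s (weight_reg (num (i :: 'n))) = weight xs (num i)"
  by (simp add: base_def table_cells_def)

lemma base_regs:
  assumes "base xs s" and "\<And>r. r \<noteq> 2 \<Longrightarrow> r < 2 \<or> 20 \<le> r \<Longrightarrow> \<rho> r = fst s r"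
  shows "base xs (\<rho>, snd s)"
  using assms(1) by (rule base_cong) (auto simp: assms(2))

definition axes :: "'n::finite list" where
  "axes = map (from_nat_into UNIV) [0..<CARD('n)]"

lemma map_num_axes: "map num (axes :: 'n::finite list) = [0..<CARD('n)]"
  by (simp add: axes_def num_from_nat_into cong: map_cong) (rule map_idI, simp add: num_from_nat_into)

lemma set_axes: "set (axes :: 'n::finite list) = UNIV"
proof -
  have "i \<in> set axes" for i :: 'n
    unfolding axes_def by (auto simp: image_iff from_nat_into_num intro!: bexI[of _ "num i"])
  then show ?thesis by blast
qed

lemma map_upt_CARD: "map f [0..<CARD('n)] = map (\<lambda>i :: 'n::finite. f (num i)) axes"
  by (simp flip: map_num_axes)

text \<open>Loops over the axes are unrolled in the program. This matches the unrolled sequence with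
  a fold on the abstract state \<open>a\<close>, for instance an edge set; the last hypothesis takes
  care of the \<open>skip\<close> that ends a sequence.\<close>

lemma sem_seqs_fold:
  assumes "I a s" and "\<And>a s e. e \<in> set es \<Longrightarrow> I a s \<Longrightarrow> I (g e a) (sem (p e) s)"
    and "\<And>a s. I a s \<Longrightarrow> I a ((fst s)(2 := 0), snd s)"
  shows "I (fold g es a) (sem (seqs (map p es)) s)"
  using assms(1,2)
proof (induction es arbitrary: a s)
  case Nil
  then show ?case
    using assms(3) by simp
next
  case (Cons e es)
  then show ?case by simp
qed

lemma degree_correct:
  fixes xs :: "(int ^ 'n::finite) list"
  assumes "base xs s" and enc: "encodes xs (snd s) E" and "r \<notin> {2, 3, 4}" and "fst s r = addr xs c"
    and near: "near xs c" "\<And>i. near xs (c - axis i 1)"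
  shows "fst (sem (degree_prog CARD('n) r) s) 4 = int (deg E c)"
proof -
  have "snd s (fst s r + (1 + int (num i)) + fst s (weight_reg (num i)))
      = of_bool ((c - axis i 1, i) \<in> E)" for i
  proof -
    have "fst s r + (1 + int (num i)) + fst s (weight_reg (num i)) = edge_addr xs (c - axis i 1) i"
      using assms(4) base_weight[OF assms(1), of i] by (simp add: addr_diff_axis edge_addr_def)
    then show ?thesis
      using enc near(2) unfolding encodes_def by metis
  qed
  moreover have "snd s (fst s r + (1 + int (num i))) = of_bool ((c, i) \<in> E)" for i
    using enc near(1) assms(4) unfolding encodes_def edge_addr_def by metis
  ultimately show ?thesis
    unfolding sem_degree_prog[OF assms(3)] sum_num degree_eq_sum by simp
qed

section \<open>Marking the occupied positions\<close>

definition mark_prog :: ram_prog where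
  "mark_prog = Seq (Const 2 1) (Store 5 2)"

definition mark_inv :: "(int ^ 'n::finite) list \<Rightarrow> nat \<Rightarrow> ram_state \<Rightarrow> bool" where
  "mark_inv xs k s \<longleftrightarrow> encodes xs (snd s) {} \<and>
    (\<forall>c. near xs c \<longrightarrow> snd s (addr xs c) = of_bool (c \<in> set (take k xs)))"

lemma lin_mark:
  "lin length (\<lambda>xs s. base xs s \<and> (\<forall>a<0. snd s a = 0)) (scan CARD('n) mark_prog)
    (\<lambda>(xs :: (int ^ 'n::finite) list) s. base xs s \<and> present xs (snd s) \<and> encodes xs (snd s) {})"
proof (rule lin_mono)
  show "lin length (\<lambda>xs s. base xs s \<and> mark_inv xs 0 s) (scan CARD('n) mark_prog)
    (\<lambda>(xs :: (int ^ 'n) list) s. base xs s \<and> mark_inv xs (length xs) s)"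
  proof (rule lin_scan)
    fix xs :: "(int ^ 'n) list" and k s
    assume A: "k < length xs" "base xs s" "mark_inv xs k s" "fst s 5 = addr xs (xs ! k)"
    have near: "near xs (xs ! k)"
      using A near_mem(1)[of xs "xs ! k"] by (simp add: base_def)
    have sem: "snd (sem mark_prog s) = (snd s)(addr xs (xs ! k) := 1)"
      using A(4) by (simp add: mark_prog_def)
    have "edge_addr xs c i \<noteq> addr xs (xs ! k)" if "near xs c" for c i
      using addr_neq_edge_addr[OF near that, of i] by simp
    moreover have "addr xs c = addr xs (xs ! k) \<longleftrightarrow> c = xs ! k" if "near xs c" for c
      using that near by (rule addr_eq_iff)
    ultimately show "mark_inv xs (Suc k) (sem mark_prog s)"
      using A(1,3) unfolding mark_inv_def encodes_def sem
      by (auto simp: take_Suc_conv_app_nth)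
    show "snd (sem mark_prog s) a = snd s a" if "0 \<le> a" "a < table_start xs CARD('n)" for a
      using that addr_neg(1)[OF near] by (simp add: sem)
  qed (auto simp: mark_prog_def mark_inv_def)
next
  fix xs :: "(int ^ 'n) list" and s
  assume "base xs s \<and> (\<forall>a<0. snd s a = 0)"
  then show "base xs s \<and> mark_inv xs 0 s"
    using addr_neg[of xs] by (simp add: mark_inv_def encodes_def)
qed (auto simp: mark_inv_def present_def)

section \<open>Entering the edges\<close>

definition link_step :: "nat \<Rightarrow> ram_prog" where
  "link_step j = seqs [Sub 3 5 (weight_reg j), Load 4 3, Const 2 (1 + int j), Add 3 5 2, Store 3 4]"

definition link_prog :: "nat \<Rightarrow> ram_prog" where
  "link_prog d = seqs (map link_step [0..<d])"

definition link_edges :: "(int ^ 'n::finite) list \<Rightarrow> (int ^ 'n) set \<Rightarrow> 'n edge set" where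
  "link_edges xs C = {(c, i)\<in>adjacencies (set xs). c \<in> C}"

lemma link_edges_simps: "link_edges xs {} = {}" "link_edges xs (set xs) = adjacencies (set xs)"
  by (auto simp: link_edges_def adjacencies_def)

text \<open>Since \<open>c\<close> is present, the presence flag of its upper neighbour is the flag
  of the edge between them and is copied without a test.\<close>

lemma sem_link_step:
  fixes xs :: "(int ^ 'n::finite) list"
  assumes "base xs s" "present xs (snd s)" "c \<in> set xs" "fst s 5 = addr xs c"
  shows "snd (sem (link_step (num i)) s) =
    (snd s)(edge_addr xs c i := of_bool ((c, i) \<in> adjacencies (set xs)))"
proof -
  have "near xs (c + axis i 1)"
    using assms(1,3) near_mem(2) by (auto simp: base_def)
  then have "snd s (addr xs c - weight xs (num i)) = of_bool ((c, i) \<in> adjacencies (set xs))"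
    using assms(2,3) by (simp add: present_def addr_add_axis[symmetric] adjacencies_def)
  then show ?thesis
    using assms(4) base_weight[OF assms(1), of i] by (simp add: link_step_def edge_addr_def)
qed

lemma lin_link:
  "lin length (\<lambda>xs s. base xs s \<and> present xs (snd s) \<and> encodes xs (snd s) {}) (scan CARD('n) (link_prog CARD('n)))
    (\<lambda>(xs :: (int ^ 'n::finite) list) s. base xs s \<and> encodes xs (snd s) (adjacencies (set xs)))"
proof (rule lin_mono)
  let ?J = "\<lambda>(xs :: (int ^ 'n) list) k s. present xs (snd s) \<and> encodes xs (snd s) (link_edges xs (set (take k xs)))"
  have main: "?J xs (Suc k) (sem (link_prog CARD('n)) s) \<and>
      (\<forall>a\<ge>0. snd (sem (link_prog CARD('n)) s) a = snd s a)"
    if A: "k < length xs" "base xs s" "?J xs k s" "fst s 5 = addr xs (xs ! k)" for xs k s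
  proof -
    let ?c = "xs ! k"
    have c: "?c \<in> set xs" and near: "near xs ?c"
      using A near_mem(1)[of xs "xs ! k"] by (simp_all add: base_def)
    define I where "I E s' \<longleftrightarrow> base xs s' \<and> present xs (snd s') \<and> encodes xs (snd s') E \<and>
      fst s' 5 = addr xs ?c \<and> (\<forall>a\<ge>0. snd s' a = snd s a)" for E and s' :: ram_state
    define g where "g i E = (if (?c, i) \<in> adjacencies (set xs) then insert (?c, i) E else E - {(?c, i)})" for i and E :: "'n edge set"
    have "I (fold g axes (link_edges xs (set (take k xs)))) (sem (seqs (map (\<lambda>i. link_step (num i)) (axes :: 'n list))) s)"
    proof (rule sem_seqs_fold[where I = I])
      show "I (link_edges xs (set (take k xs))) s"
        using A by (simp add: I_def)
      show "I E ((fst s')(2 := 0), snd s')" if "I E s'" for E s'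
        using that base_regs[of xs s' "(fst s')(2 := 0)"] by (simp add: I_def)
      fix E s' i assume I: "I E s'"
      have sem: "snd (sem (link_step (num i)) s') =
          (snd s')(edge_addr xs ?c i := of_bool ((?c, i) \<in> adjacencies (set xs)))"
        using I c by (intro sem_link_step) (auto simp: I_def)
      have regs: "fst (sem (link_step (num i)) s') r = fst s' r" if "r \<notin> {2, 3, 4}" for r
        using that by (intro sem_frame) (simp add: link_step_def)
      have old: "snd (sem (link_step (num i)) s') a = snd s' a" if "0 \<le> a" for a
        using that addr_neg(2)[OF near, of i] by (simp add: sem)
      have "base xs (sem (link_step (num i)) s')"
      proof (rule base_cong)
        show "base xs s'"
          using I by (simp add: I_def)
      qed (auto simp: regs old)
      then show "I (g i E) (sem (link_step (num i)) s')"
        using I near old unfolding I_def g_def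
        by (simp add: sem regs present_update encodes_update del: of_bool_eq)
    qed
    moreover have "fold g axes (link_edges xs (set (take k xs))) = link_edges xs (set (take (Suc k) xs))"
    proof -
      have "fold g is E = E - {?c} \<times> set is \<union> {(?c, i) | i. i \<in> set is \<and> (?c, i) \<in> adjacencies (set xs)}" for "is" E
        by (induction "is" arbitrary: E) (auto simp: g_def)
      then show ?thesis
        using A(1) by (auto simp: set_axes link_edges_def take_Suc_conv_app_nth)
    qed
    ultimately show ?thesis
      unfolding link_prog_def map_upt_CARD by (simp add: I_def)
  qed
  show "lin length (\<lambda>xs s. base xs s \<and> ?J xs 0 s) (scan CARD('n) (link_prog CARD('n)))
    (\<lambda>xs s. base xs s \<and> ?J xs (length xs) s)"
  proof (rule lin_scan)
    show "loop_free (link_prog CARD('n))" "writes (link_prog CARD('n)) \<subseteq> {2..<20} - {6, 7}"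
      by (auto simp: link_prog_def link_step_def)
  qed (use main in auto)
qed (simp_all add: link_edges_simps)

section \<open>Deleting edges in memory\<close>

definition over_prog :: "nat \<Rightarrow> reg \<Rightarrow> ram_prog" where
  "over_prog d r = Seq (degree_prog d r) (Seq (Const 2 1) (Sub 4 4 2))"

definition edge_load :: "nat \<Rightarrow> ram_prog" where
  "edge_load j = Seq (Const 2 (1 + int j)) (Seq (Add 3 5 2) (Load 2 3))"

definition edge_clear :: "nat \<Rightarrow> ram_prog" where
  "edge_clear j = Seq (Const 2 (1 + int j)) (Seq (Add 3 5 2) (Seq (Const 2 0) (Store 3 2)))"

definition prune_step :: "nat \<Rightarrow> nat \<Rightarrow> ram_prog" where
  "prune_step d j = Seq (edge_load j) (IfPos 2 (Seq (over_prog d 5) (IfPos 4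
     (Seq (Sub 12 5 (weight_reg j)) (Seq (over_prog d 12) (IfPos 4 (edge_clear j) skip))) skip)) skip)"

lemma over_prog_simps [simp]:
  "loop_free (over_prog d r)" "\<not> stores (over_prog d r)" "snd (sem (over_prog d r) s) = snd s"
  by (simp_all add: over_prog_def sem_no_store)

lemma writes_over_prog: "writes (over_prog d r) \<subseteq> {2, 3, 4}"
  using degree_prog_simps(2)[of d r] by (auto simp: over_prog_def)

lemma fst_over_prog: "q \<notin> {2, 3, 4} \<Longrightarrow> fst (sem (over_prog d r) s) q = fst s q"
  using writes_over_prog[of d r] by (intro sem_frame) blast

text \<open>Tests can only ask whether a register is positive, so 1 is subtracted from the degree in
  order to detect degree at least 2.\<close>

lemma over_prog_correct:
  fixes xs :: "(int ^ 'n::finite) list"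
  assumes "base xs s" "encodes xs (snd s) E" "r \<notin> {2, 3, 4}" "fst s r = addr xs c"
    and "near xs c" "\<And>i. near xs (c - axis i 1)"
  shows "0 < fst (sem (over_prog CARD('n) r) s) 4 \<longleftrightarrow> deg E c > 1"
  using degree_correct[OF assms] by (simp add: over_prog_def)

lemma edge_load_simps [simp]:
  "loop_free (edge_load j)" "writes (edge_load j) = {2, 3}" "\<not> stores (edge_load j)"
  "snd (sem (edge_load j) s) = snd s"
  by (auto simp: edge_load_def)

lemma fst_edge_load: "q \<notin> {2, 3} \<Longrightarrow> fst (sem (edge_load j) s) q = fst s q"
  by (intro sem_frame) simp

lemma edge_load_correct:
  fixes xs :: "(int ^ 'n::finite) list"
  assumes "encodes xs (snd s) E" "fst s 5 = addr xs c" "near xs c"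
  shows "fst (sem (edge_load (num (i :: 'n))) s) 2 = of_bool ((c, i) \<in> E)"
  using assms by (simp add: edge_load_def encodes_def edge_addr_def)

lemma base_no_store:
  assumes "base xs s" and "\<not> stores p" and "writes p \<subseteq> {2..<20}"
  shows "base xs (sem p s)"
  using assms(1)
proof (rule base_cong)
  show "fst (sem p s) r = fst s r" if "r < 2 \<or> 20 \<le> r" for r
    using assms(3) that by (intro sem_frame) auto
qed (simp add: assms(2) sem_no_store)

lemma base_over_prog: "base xs s \<Longrightarrow> base xs (sem (over_prog d r) s)"
  using writes_over_prog[of d r] by (intro base_no_store) auto

lemma base_edge_load: "base xs s \<Longrightarrow> base xs (sem (edge_load j) s)"
  by (intro base_no_store) auto

lemma upper_over_prog_correct:
  fixes xs :: "(int ^ 'n::finite) list"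
  assumes s: "base xs s" "encodes xs (snd s) E" "fst s 5 = addr xs c" and c: "c \<in> set xs"
  shows "0 < fst (sem (over_prog CARD('n) 12) (sem (Sub 12 5 (weight_reg (num i))) s)) 4 \<longleftrightarrow>
    deg E (c + axis i 1) > 1"
proof (rule over_prog_correct)
  have good: "proper_input xs"
    using s(1) by (simp add: base_def)
  show "near xs (c + axis i 1)" "\<And>j. near xs (c + axis i 1 - axis j 1)"
    using near_mem[OF good c] by auto
  show "base xs (sem (Sub 12 5 (weight_reg (num i))) s)"
    using s(1) by (intro base_no_store) auto
  show "fst (sem (Sub 12 5 (weight_reg (num i))) s) 12 = addr xs (c + axis i 1)"
    using s(3) base_weight[OF s(1), of i] by (simp add: addr_add_axis)
qed (use s in simp_all)

lemma sem_prune_step: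
  fixes xs :: "(int ^ 'n::finite) list"
  assumes s: "base xs s" "encodes xs (snd s) E" "fst s 5 = addr xs c" and c: "c \<in> set xs"
  shows "snd (sem (prune_step CARD('n) (num i)) s) =
    (if (c, i) \<in> E \<and> deg E c > 1 \<and> deg E (c + axis i 1) > 1
     then (snd s)(edge_addr xs c i := 0) else snd s)"
proof -
  have near: "near xs c" "\<And>j. near xs (c - axis j 1)"
    using near_mem[OF _ c] s(1) by (auto simp: base_def)
  define s1 where "s1 = sem (edge_load (num i)) s"
  define s2 where "s2 = sem (over_prog CARD('n) 5) s1"
  define s3 where "s3 = sem (over_prog CARD('n) 12) (sem (Sub 12 5 (weight_reg (num i))) s2)"
  have snd: "snd s1 = snd s" "snd s2 = snd s" "snd s3 = snd s"
    by (simp_all add: s1_def s2_def s3_def)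
  have r5: "fst s1 5 = addr xs c" "fst s2 5 = addr xs c" "fst s3 5 = addr xs c"
    using s(3) by (simp_all add: s1_def s2_def s3_def fst_edge_load fst_over_prog)
  have b: "base xs s1" "base xs s2"
    using s(1) by (simp_all add: s1_def s2_def base_edge_load base_over_prog)
  have 1: "fst s1 2 = of_bool ((c, i) \<in> E)"
    unfolding s1_def using s near by (intro edge_load_correct) auto
  have 2: "0 < fst s2 4 \<longleftrightarrow> deg E c > 1"
    unfolding s2_def using b s r5 snd near by (intro over_prog_correct) auto
  have 3: "0 < fst s3 4 \<longleftrightarrow> deg E (c + axis i 1) > 1"
    unfolding s3_def using b s r5 snd c by (intro upper_over_prog_correct) auto
  have 4: "snd (sem (edge_clear (num i)) s3) = (snd s)(edge_addr xs c i := 0)"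
    using r5 snd by (simp add: edge_clear_def edge_addr_def)
  have "sem (prune_step CARD('n) (num i)) s =
      (if 0 < fst s1 2 then if 0 < fst s2 4 then if 0 < fst s3 4 then sem (edge_clear (num i)) s3
       else sem skip s3 else sem skip s2 else sem skip s1)"
    unfolding prune_step_def s1_def s2_def s3_def by simp
  then show ?thesis
    using 1 2 3 4 snd by auto
qed

definition prune_prog :: "nat \<Rightarrow> ram_prog" where
  "prune_prog d = seqs (map (prune_step d) [0..<d])"

text \<open>All pairs of a cube and an axis are listed in the order in which the program visits
  them; pairs that are no edges do no harm, as \<open>prune\<close> leaves the graph unchanged
  there.\<close>

definition edge_list :: "(int ^ 'n::finite) list \<Rightarrow> 'n edge list" where
  "edge_list cs = concat (map (\<lambda>c. map (Pair c) axes) cs)"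

definition pruned :: "(int ^ 'n::finite) list \<Rightarrow> nat \<Rightarrow> 'n edge set" where
  "pruned xs k = fold prune (edge_list (take k xs)) (adjacencies (set xs))"

lemma writes_prune_step: "writes (prune_step d j) \<subseteq> {2, 3, 4, 12}"
  using writes_over_prog[of d 5] writes_over_prog[of d 12] by (auto simp: prune_step_def edge_clear_def)

lemma lin_prune:
  "lin length (\<lambda>xs s. base xs s \<and> encodes xs (snd s) (adjacencies (set xs)))
    (scan CARD('n) (prune_prog CARD('n)))
    (\<lambda>(xs :: (int ^ 'n::finite) list) s. base xs s \<and> encodes xs (snd s) (pruned xs (length xs)))"
proof (rule lin_mono)
  let ?J = "\<lambda>(xs :: (int ^ 'n) list) k s. encodes xs (snd s) (pruned xs k)"
  have main: "?J xs (Suc k) (sem (prune_prog CARD('n)) s) \<and>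
      (\<forall>a\<ge>0. snd (sem (prune_prog CARD('n)) s) a = snd s a)"
    if A: "k < length xs" "base xs s" "?J xs k s" "fst s 5 = addr xs (xs ! k)" for xs k s
  proof -
    let ?c = "xs ! k"
    have c: "?c \<in> set xs" and near: "near xs ?c"
      using A near_mem(1)[of xs "xs ! k"] by (simp_all add: base_def)
    define I where "I E s' \<longleftrightarrow> base xs s' \<and> encodes xs (snd s') E \<and>
      fst s' 5 = addr xs ?c \<and> (\<forall>a\<ge>0. snd s' a = snd s a)" for E and s' :: ram_state
    define g where "g i = prune (?c, i)" for i :: 'n
    have "I (fold g axes (pruned xs k)) (sem (seqs (map (\<lambda>i. prune_step CARD('n) (num i)) (axes :: 'n list))) s)"
    proof (rule sem_seqs_fold[where I = I])
      show "I (pruned xs k) s"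
        using A by (simp add: I_def)
      show "I E ((fst s')(2 := 0), snd s')" if "I E s'" for E s'
        using that base_regs[of xs s' "(fst s')(2 := 0)"] by (simp add: I_def)
      fix E s' and i :: 'n assume I: "I E s'"
      let ?s = "sem (prune_step CARD('n) (num i)) s'"
      let ?b = "(?c, i) \<in> E \<and> deg E ?c > 1 \<and> deg E (?c + axis i 1) > 1"
      have sem: "snd ?s = (if ?b then (snd s')(edge_addr xs ?c i := of_bool False) else snd s')"
        using I c by (subst sem_prune_step[where E = E]) (auto simp: I_def)
      have regs: "fst ?s r = fst s' r" if "r \<notin> {2, 3, 4, 12}" for r
        using that writes_prune_step by (intro sem_frame) blast
      have old: "snd ?s a = snd s' a" if "0 \<le> a" for a
        using that addr_neg(2)[OF near, of i] by (simp add: sem)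
      have "base xs ?s"
      proof (rule base_cong)
        show "base xs s'"
          using I by (simp add: I_def)
      qed (auto simp: regs old)
      moreover have "encodes xs (snd ?s) (g i E)"
      proof (cases ?b)
        case True
        then have g: "g i E = E - {(?c, i)}"
          by (simp add: g_def prune_def)
        have "snd ?s = (snd s')(edge_addr xs ?c i := of_bool False)"
          unfolding sem using True by (rule if_P)
        moreover have "encodes xs (snd s') E"
          using I by (simp add: I_def)
        ultimately show ?thesis
          using encodes_update[of xs "snd s'" E ?c i False] near g by simp
      next
        case False
        then have "g i E = E"
          by (auto simp: g_def prune_def)
        moreover have "snd ?s = snd s'"
          unfolding sem using False by (rule if_not_P)
        ultimately show ?thesis
          using I by (simp add: I_def)
      qed
      ultimately show "I (g i E) ?s"
        using I old by (simp add: I_def regs)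
    qed
    moreover have "g = prune \<circ> Pair ?c"
      by (simp add: g_def fun_eq_iff)
    then have "fold g axes (pruned xs k) = pruned xs (Suc k)"
      using A(1) by (simp add: pruned_def take_Suc_conv_app_nth edge_list_def fold_map)
    ultimately show ?thesis
      unfolding prune_prog_def map_upt_CARD by (simp add: I_def)
  qed
  show "lin length (\<lambda>xs s. base xs s \<and> ?J xs 0 s) (scan CARD('n) (prune_prog CARD('n)))
    (\<lambda>xs s. base xs s \<and> ?J xs (length xs) s)"
  proof (rule lin_scan)
    show "loop_free (prune_prog CARD('n))"
      by (auto simp: prune_prog_def prune_step_def edge_clear_def)
    show "writes (prune_prog CARD('n)) \<subseteq> {2..<20} - {6, 7}"
      by (auto simp: prune_prog_def dest: subsetD[OF writes_prune_step])
  qed (use main in auto)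
qed (auto simp: pruned_def edge_list_def)

section \<open>Recognising the centres\<close>

definition centre_step :: "nat \<Rightarrow> nat \<Rightarrow> ram_prog" where
  "centre_step d j = Seq (edge_load j) (IfPos 2 (Seq (Sub 12 5 (weight_reg j))
     (Seq (over_prog d 12) (IfPos 4 skip (Const 9 1)))) skip)"

definition centre_prog :: "nat \<Rightarrow> ram_prog" where
  "centre_prog d = Seq (Seq (over_prog d 5) (Seq (Const 2 0) (Add 9 4 2))) (seqs (map (centre_step d) [0..<d]))"

lemma centre_step_simps:
  "loop_free (centre_step d j)" "\<not> stores (centre_step d j)" "writes (centre_step d j) \<subseteq> {2, 3, 4, 9, 12}"
  using writes_over_prog[of d 12] by (auto simp: centre_step_def)

lemma centre_prog_simps:
  "loop_free (centre_prog d)" "\<not> stores (centre_prog d)" "writes (centre_prog d) \<subseteq> {2, 3, 4, 9, 12}"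
  using writes_over_prog[of d 5]
  by (auto simp: centre_prog_def centre_step_simps dest: subsetD[OF centre_step_simps(3)])

lemma sem_centre_step:
  fixes xs :: "(int ^ 'n::finite) list"
  assumes s: "base xs s" "encodes xs (snd s) E" "fst s 5 = addr xs c" and c: "c \<in> set xs"
  shows "fst (sem (centre_step CARD('n) (num i)) s) 9 =
    (if (c, i) \<in> E \<and> deg E (c + axis i 1) \<le> 1 then 1 else fst s 9)"
proof -
  have near: "near xs c"
    using near_mem[OF _ c] s(1) by (auto simp: base_def)
  define s1 where "s1 = sem (edge_load (num i)) s"
  define s2 where "s2 = sem (over_prog CARD('n) 12) (sem (Sub 12 5 (weight_reg (num i))) s1)"
  have r: "fst s1 9 = fst s 9" "fst s2 9 = fst s 9" "fst s1 5 = addr xs c" "snd s1 = snd s"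
    using s(3) by (simp_all add: s1_def s2_def fst_edge_load fst_over_prog)
  have 1: "fst s1 2 = of_bool ((c, i) \<in> E)"
    unfolding s1_def using s near by (intro edge_load_correct) auto
  have 2: "0 < fst s2 4 \<longleftrightarrow> deg E (c + axis i 1) > 1"
    unfolding s2_def using s r c by (intro upper_over_prog_correct) (auto simp: s1_def base_edge_load)
  have "sem (centre_step CARD('n) (num i)) s =
      (if 0 < fst s1 2 then if 0 < fst s2 4 then sem skip s2 else sem (Const 9 1) s2 else sem skip s1)"
    unfolding centre_step_def s1_def s2_def by simp
  then show ?thesis
    using 1 2 r by auto
qed

text \<open>Register 9 starts with the degree minus 1 and can afterwards only be set to 1, so that
  its positivity is the disjunction defining \<open>centre\<close>.\<close>

lemma centre_prog_correct:
  fixes xs :: "(int ^ 'n::finite) list"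
  assumes s: "base xs s" "encodes xs (snd s) E" "fst s 5 = addr xs c" and c: "c \<in> set xs"
  shows "0 < fst (sem (centre_prog CARD('n)) s) 9 \<longleftrightarrow> centre E c"
proof -
  have near: "near xs c" "\<And>j. near xs (c - axis j 1)"
    using near_mem[OF _ c] s(1) by (auto simp: base_def)
  define s1 where "s1 = sem (Seq (over_prog CARD('n) 5) (Seq (Const 2 0) (Add 9 4 2))) s"
  define I where "I a s' \<longleftrightarrow> base xs s' \<and> snd s' = snd s \<and> fst s' 5 = addr xs c \<and> (0 < fst s' 9 \<longleftrightarrow> a)"
    for a and s' :: ram_state
  define g where "g i a \<longleftrightarrow> a \<or> (c, i) \<in> E \<and> deg E (c + axis i 1) \<le> 1" for i :: 'n and a
  have "I (fold g axes (deg E c > 1)) (sem (seqs (map (\<lambda>i. centre_step CARD('n) (num i)) (axes :: 'n list))) s1)"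
  proof (rule sem_seqs_fold[where I = I])
    have "0 < fst (sem (over_prog CARD('n) 5) s) 4 \<longleftrightarrow> deg E c > 1"
      using s near by (intro over_prog_correct) auto
    moreover have "base xs s1"
      unfolding s1_def using s(1) writes_over_prog[of "CARD('n)" 5] by (intro base_no_store) auto
    ultimately show "I (deg E c > 1) s1"
      using s by (simp add: I_def s1_def fst_over_prog)
    show "I a ((fst s')(2 := 0), snd s')" if "I a s'" for a s'
      using that base_regs[of xs s' "(fst s')(2 := 0)"] by (simp add: I_def)
    fix a s' and i :: 'n assume I: "I a s'"
    let ?s = "sem (centre_step CARD('n) (num i)) s'"
    have "fst ?s 9 = (if (c, i) \<in> E \<and> deg E (c + axis i 1) \<le> 1 then 1 else fst s' 9)"
      using I s c by (intro sem_centre_step) (auto simp: I_def)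
    moreover have "5 \<notin> writes (centre_step CARD('n) (num i))"
      using centre_step_simps(3)[of "CARD('n)" "num i"] by auto
    then have "fst ?s 5 = fst s' 5"
      by (rule sem_frame)
    moreover have "writes (centre_step CARD('n) (num i)) \<subseteq> {2..<20}"
      by (rule order_trans[OF centre_step_simps(3)]) auto
    then have "base xs ?s"
      using I centre_step_simps(2) unfolding I_def by (intro base_no_store) blast+
    moreover have "snd ?s = snd s'"
      by (simp add: sem_no_store centre_step_simps)
    ultimately show "I (g i a) ?s"
      using I by (auto simp: I_def g_def)
  qed
  moreover have "fold g is a \<longleftrightarrow> a \<or> (\<exists>i\<in>set is. (c, i) \<in> E \<and> deg E (c + axis i 1) \<le> 1)" for "is" a
    by (induction "is" arbitrary: a) (auto simp: g_def)
  ultimately show ?thesis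
    unfolding centre_prog_def map_upt_CARD by (simp add: I_def centre_def set_axes s1_def)
qed

section \<open>Writing the tiling\<close>

text \<open>An entry of an output record is a constant or a coordinate of the current cube.\<close>

definition emit_step :: "int + nat \<Rightarrow> ram_prog" where
  "emit_step e = Seq
     (case e of Inl k \<Rightarrow> Const 4 k | Inr j \<Rightarrow> Seq (Const 2 (int j)) (Seq (Add 3 6 2) (Load 4 3)))
     (Seq (Store 8 4) (Seq (Const 2 1) (Add 8 8 2)))"

definition emit :: "(int + nat) list \<Rightarrow> ram_prog" where
  "emit es = seqs (map emit_step es)"

definition entry :: "(int \<Rightarrow> int) \<Rightarrow> int \<Rightarrow> int + nat \<Rightarrow> int" where
  "entry \<mu> b e = (case e of Inl k \<Rightarrow> k | Inr j \<Rightarrow> \<mu> (b + int j))"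

lemma emit_simps: "loop_free (emit es)" "writes (emit es) \<subseteq> {2, 3, 4, 8}"
  by (auto simp: emit_def emit_step_def split: sum.splits)

lemma sem_emit_step:
  "snd (sem (emit_step e) s) = (snd s)(fst s 8 := entry (snd s) (fst s 6) e)"
  "fst (sem (emit_step e) s) 8 = fst s 8 + 1" "fst (sem (emit_step e) s) 6 = fst s 6"
  by (simp_all add: emit_step_def entry_def split: sum.splits)

text \<open>The hypothesis on \<open>p + int j\<close> says that coordinates are read below the area
  being written. Thus all entries can be evaluated in the initial memory.\<close>

lemma sem_emit:
  assumes "fst s 8 = q" and "fst s 6 = p" and "\<And>j. Inr j \<in> set es \<Longrightarrow> p + int j < q"
  shows "snd (sem (emit es) s) = (\<lambda>a. if q \<le> a \<and> a < q + int (length es)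
      then entry (snd s) p (es ! nat (a - q)) else snd s a) \<and>
    fst (sem (emit es) s) 8 = q + int (length es)"
  using assms
proof (induction es arbitrary: s q)
  case Nil
  then show ?case
    by (auto simp: emit_def)
next
  case (Cons e es)
  define s1 where "s1 = sem (emit_step e) s"
  have s1: "snd s1 = (snd s)(q := entry (snd s) p e)" "fst s1 8 = q + 1" "fst s1 6 = p"
    using Cons.prems(1,2) by (simp_all add: s1_def sem_emit_step)
  have "sem (emit (e # es)) s = sem (emit es) s1"
    by (simp add: emit_def s1_def)
  moreover have "p + int j < q + 1" if "Inr j \<in> set es" for j
    using Cons.prems(3)[of j] that by simp
  then have IH: "snd (sem (emit es) s1) =
      (\<lambda>a. if q + 1 \<le> a \<and> a < q + 1 + int (length es)
           then entry (snd s1) p (es ! nat (a - (q + 1))) else snd s1 a)"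
    "fst (sem (emit es) s1) 8 = q + 1 + int (length es)"
    using Cons.IH[OF s1(2,3)] by simp_all
  moreover have same: "entry (snd s1) p e' = entry (snd s) p e'" if "e' \<in> set es" for e'
    using Cons.prems(3) that by (cases e') (force simp: entry_def s1)+
  have "snd (sem (emit es) s1) a =
      (if q \<le> a \<and> a < q + int (length (e # es))
       then entry (snd s) p ((e # es) ! nat (a - q)) else snd s a)" for a
  proof (cases "q + 1 \<le> a \<and> a < q + 1 + int (length es)")
    case True
    then have "nat (a - q) = Suc (nat (a - (q + 1)))" "nat (a - (q + 1)) < length es"
      by linarith+
    then show ?thesis
      using True same[of "es ! nat (a - (q + 1))"] by (simp add: IH)
  next
    case False
    then have "snd (sem (emit es) s1) a = snd s1 a"
      unfolding IH(1) by (rule if_not_P)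
    moreover have "a = q \<or> \<not> (q \<le> a \<and> a < q + int (length (e # es)))"
      using False by auto
    ultimately show ?thesis
      by (auto simp: s1)
  qed
  ultimately show ?case
    by auto
qed

text \<open>For every set of arms, the number of a tile and a rotation taking that tile to the star.
  The program is built from such a function.\<close>

type_synonym 'n choice = "('n \<times> bool) set \<Rightarrow> nat \<times> (int ^ 'n ^ 'n)"

definition record_size :: "'n::finite itself \<Rightarrow> nat" where
  "record_size _ = 1 + CARD('n) * CARD('n) + CARD('n)"

definition record_entries :: "('n::finite) choice \<Rightarrow> ('n \<times> bool) set \<Rightarrow> (int + nat) list" where
  "record_entries f A = Inl (int (fst (f A))) #
     map (\<lambda>m. Inl (snd (f A) $ from_nat_into UNIV (m div CARD('n)) $ from_nat_into UNIV (m mod CARD('n))))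
       [0..<CARD('n) * CARD('n)] @
     map Inr [0..<CARD('n)]"

lemma length_record_entries: "length (record_entries (f :: 'n::finite choice) A) = record_size TYPE('n)"
  by (simp add: record_entries_def record_size_def)

lemma matrix_index: "num (i :: 'n::finite) * CARD('n) + num (j :: 'n) < CARD('n) * CARD('n)"
proof -
  have "num i * CARD('n) + num j < Suc (num i) * CARD('n)"
    by simp
  also have "\<dots> \<le> CARD('n) * CARD('n)"
    by (intro mult_le_mono1 Suc_leI num_less)
  finally show ?thesis .
qed

lemma read_record:
  fixes f :: "('n::finite) choice"
  assumes \<mu>: "\<And>m. m < record_size TYPE('n) \<Longrightarrow> \<mu> (b + int m) = entry \<mu>0 p (record_entries f A ! m)"
    and c: "\<And>i :: 'n. \<mu>0 (p + int (num i)) = c $ i"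
  shows "read_placement \<mu> b = (int (fst (f A)), snd (f A), c)"
proof -
  have "\<mu> b = int (fst (f A))"
    using \<mu>[of 0] by (simp add: record_size_def record_entries_def entry_def)
  moreover have "\<mu> (b + 1 + int (num i * CARD('n) + num j)) = snd (f A) $ i $ j" for i j
  proof -
    have "record_entries f A ! (1 + (num i * CARD('n) + num j)) = Inl (snd (f A) $ i $ j)"
      using matrix_index[of i j] by (simp add: record_entries_def nth_append from_nat_into_num)
    then show ?thesis
      using \<mu>[of "1 + (num i * CARD('n) + num j)"] matrix_index[of i j]
      by (simp add: record_size_def entry_def add.assoc)
  qed
  moreover have "\<mu> (b + 1 + int (CARD('n) * CARD('n) + num i)) = c $ i" for i
  proof -
    have "record_entries f A ! (1 + (CARD('n) * CARD('n) + num i)) = Inr (num i)"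
      by (simp add: record_entries_def nth_append)
    then show ?thesis
      using \<mu>[of "1 + (CARD('n) * CARD('n) + num i)"] c[of i]
      by (simp add: record_size_def entry_def add.assoc)
  qed
  ultimately show ?thesis
    by (simp add: read_placement_def vec_eq_iff)
qed

lemma read_placement_cong:
  assumes "\<And>m. m < record_size TYPE('n) \<Longrightarrow> \<mu>' (b + int m) = \<mu> (b + int m)"
  shows "(read_placement \<mu>' b :: ('n::finite) placement) = read_placement \<mu> b"
proof -
  have "\<mu>' b = \<mu> b"
    using assms[of 0] by (simp add: record_size_def)
  moreover have "\<mu>' (b + 1 + int (num i * CARD('n) + num j)) = \<mu> (b + 1 + int (num i * CARD('n) + num j))"
    for i j :: 'n
    using assms[of "1 + (num i * CARD('n) + num j)"] matrix_index[of i j]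
    by (simp add: record_size_def add.assoc)
  moreover have "\<mu>' (b + 1 + int (CARD('n) * CARD('n) + num i)) = \<mu> (b + 1 + int (CARD('n) * CARD('n) + num i))"
    for i :: 'n
    using assms[of "1 + (CARD('n) * CARD('n) + num i)"] by (simp add: record_size_def add.assoc)
  ultimately show ?thesis
    by (simp add: read_placement_def)
qed

definition flag_load :: "('n::finite \<times> bool) \<Rightarrow> ram_prog" where
  "flag_load = (\<lambda>(i, s). Seq (Const 2 (1 + int (num i))) (Seq (Add 3 5 2)
     (if s then Load 2 3 else Seq (Add 3 3 (weight_reg (num i))) (Load 2 3))))"

lemma flag_load_simps [simp]:
  "loop_free (flag_load p)" "writes (flag_load p) = {2, 3}" "\<not> stores (flag_load p)"
  "snd (sem (flag_load p) s) = snd s"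
  by (auto simp: flag_load_def split: prod.splits)

lemma flag_load_correct:
  fixes xs :: "(int ^ 'n::finite) list"
  assumes s: "base xs s" "encodes xs (snd s) E" "fst s 5 = addr xs c" and c: "c \<in> set xs"
  shows "0 < fst (sem (flag_load p) s) 2 \<longleftrightarrow> p \<in> dirs E c"
proof -
  obtain i t where p: "p = (i, t)"
    by fastforce
  have near: "near xs c" "near xs (c - axis i 1)"
    using near_mem[OF _ c] s(1) by (auto simp: base_def)
  have a: "fst s 5 + (1 + int (num i)) = edge_addr xs c i"
    "fst s 5 + (1 + int (num i)) + fst s (weight_reg (num i)) = edge_addr xs (c - axis i 1) i"
    using s(3) base_weight[OF s(1), of i] by (simp_all add: edge_addr_def addr_diff_axis)
  show ?thesis
  proof (cases t)
    case True
    then have "fst (sem (flag_load p) s) 2 = snd s (edge_addr xs c i)"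
      unfolding a(1)[symmetric] by (simp add: p flag_load_def)
    then show ?thesis
      using s(2) near True by (simp add: p encodes_def)
  next
    case False
    then have "fst (sem (flag_load p) s) 2 = snd s (edge_addr xs (c - axis i 1) i)"
      unfolding a(2)[symmetric] by (simp add: p flag_load_def)
    then show ?thesis
      using s(2) near False by (simp add: p encodes_def)
  qed
qed

text \<open>
  The rotation of a tile depends on the set of its arms, which is determined by a binary decision
  tree; the constants to be written are at its leaves.
\<close>

fun decide :: "('n::finite \<times> bool) list \<Rightarrow> (('n \<times> bool) set \<Rightarrow> ram_prog) \<Rightarrow> ('n \<times> bool) set \<Rightarrow> ram_prog"
  where
  "decide [] w A = w A"
| "decide (p # ps) w A = Seq (flag_load p) (IfPos 2 (decide ps w (insert p A)) (decide ps w A))"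

lemma loop_free_decide: "(\<And>A. loop_free (w A)) \<Longrightarrow> loop_free (decide ps w A)"
  by (induction ps arbitrary: A) auto

lemma writes_decide: "writes (decide ps w A) \<subseteq> {2, 3} \<union> (\<Union>A. writes (w A))"
proof (induction ps arbitrary: A)
  case (Cons p ps)
  show ?case
    using Cons.IH[of A] Cons.IH[of "insert p A"] by auto
qed auto

text \<open>\<open>A\<close> collects the directions found so far. Starting from the empty set with
  all directions to be tested, the leaf reached is the one for \<open>dirs E c\<close>.\<close>

lemma sem_decide:
  fixes xs :: "(int ^ 'n::finite) list"
  assumes "base xs s" "encodes xs (snd s) E" "fst s 5 = addr xs c" and c: "c \<in> set xs"
  shows "\<exists>\<rho>. (\<forall>r. r \<notin> {2, 3} \<longrightarrow> \<rho> r = fst s r) \<and>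
    sem (decide ps w A) s = sem (w (A \<union> (set ps \<inter> dirs E c))) (\<rho>, snd s)"
  using assms(1-3)
proof (induction ps arbitrary: A s)
  case Nil
  show ?case
    by (intro exI[of _ "fst s"]) simp
next
  case (Cons p ps)
  define s1 where "s1 = sem (flag_load p) s"
  have regs: "fst s1 r = fst s r" if "r \<notin> {2, 3}" for r
    unfolding s1_def using that by (intro sem_frame) simp
  have s1: "snd s1 = snd s"
    by (simp add: s1_def)
  have b: "base xs s1"
    unfolding s1_def using Cons.prems(1) by (intro base_no_store) auto
  have e: "encodes xs (snd s1) E" and a: "fst s1 5 = addr xs c"
    using Cons.prems(2,3) by (simp_all add: s1 regs)
  define A' where "A' = (if p \<in> dirs E c then insert p A else A)"
  have "sem (decide (p # ps) w A) s = sem (decide ps w A') s1"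
    using flag_load_correct[OF Cons.prems c, of p] by (simp add: s1_def A'_def)
  moreover obtain \<rho> where "\<forall>r. r \<notin> {2, 3} \<longrightarrow> \<rho> r = fst s1 r"
    "sem (decide ps w A') s1 = sem (w (A' \<union> (set ps \<inter> dirs E c))) (\<rho>, snd s1)"
    using Cons.IH[OF b e a] by blast
  moreover have "A' \<union> (set ps \<inter> dirs E c) = A \<union> (set (p # ps) \<inter> dirs E c)"
    by (auto simp: A'_def)
  ultimately show ?case
    by (intro exI[of _ \<rho>]) (simp add: regs s1)
qed

definition dir_list :: "('n::finite \<times> bool) list" where
  "dir_list = List.product axes [True, False]"

lemma set_dir_list: "set dir_list = UNIV"
  by (auto simp: dir_list_def set_axes)

definition write_record :: "('n::finite) choice \<Rightarrow> ('n \<times> bool) set \<Rightarrow> ram_prog" where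
  "write_record f A = Seq (emit (record_entries f A)) (Seq (Const 2 1) (Add 11 11 2))"

definition output_prog :: "('n::finite) choice \<Rightarrow> ram_prog" where
  "output_prog f = Seq (centre_prog CARD('n)) (IfPos 9 (decide dir_list (write_record f) {}) skip)"

definition placed :: "('n::finite) choice \<Rightarrow> 'n edge set \<Rightarrow> int ^ 'n \<Rightarrow> 'n placement" where
  "placed f E c = (int (fst (f (dirs E c))), snd (f (dirs E c)), c)"

definition output_inv :: "('n::finite) choice \<Rightarrow> (int ^ 'n) list \<Rightarrow> nat \<Rightarrow> ram_state \<Rightarrow> bool" where
  "output_inv f xs k s \<longleftrightarrow> (let E = pruned xs (length xs); cs = filter (centre E) (take k xs) in
     encodes xs (snd s) E \<and> fst s 11 = int (length cs) \<and>
     fst s 8 = table_start xs CARD('n) + int (length cs * record_size TYPE('n)) \<and>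
     (\<forall>m<length cs. read_placement (snd s) (table_start xs CARD('n) + int (m * record_size TYPE('n)))
        = placed f E (cs ! m)))"

lemma encodes_cong:
  fixes xs :: "(int ^ 'n::finite) list"
  assumes "encodes xs \<mu> E" and "\<And>a. a < 0 \<Longrightarrow> \<mu>' a = \<mu> a"
  shows "encodes xs \<mu>' E"
  unfolding encodes_def
proof (intro allI impI)
  fix c and i :: 'n assume "near xs c"
  then show "\<mu>' (edge_addr xs c i) = of_bool ((c, i) \<in> E)"
    using assms(1) assms(2)[OF addr_neg(2)[of xs c i]] by (simp add: encodes_def)
qed

lemma output_prog_writes: "writes (output_prog f) \<subseteq> {2, 3, 4, 8, 9, 11, 12}"
proof -
  have "writes (write_record f A) \<subseteq> {2, 3, 4, 8, 11}" for A
    using emit_simps(2)[of "record_entries f A"] by (auto simp: write_record_def)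
  then have "writes (decide dir_list (write_record f) {}) \<subseteq> {2, 3, 4, 8, 11}"
    by (intro order_trans[OF writes_decide]) (auto simp: UN_subset_iff)
  then show ?thesis
    using centre_prog_simps(3)[of "CARD('a)"] by (auto simp: output_prog_def)
qed

text \<open>A new record is written above the earlier ones, above the input and the tables, and away
  from the graph at negative addresses, so everything established before survives.\<close>

lemma output_prog_step:
  fixes f :: "('n::finite) choice"
  assumes k: "k < length xs" and b: "base xs s" and J: "output_inv f xs k s"
    and r6: "fst s 6 = int (k * CARD('n))" and r5: "fst s 5 = addr xs (xs ! k)"
  shows "output_inv f xs (Suc k) (sem (output_prog f) s)"
    and "a < table_start xs CARD('n) \<Longrightarrow> snd (sem (output_prog f) s) a = snd s a"
proof -
  define E where "E = pruned xs (length xs)"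
  define cs where "cs = filter (centre E) (take k xs)"
  define S where "S = record_size TYPE('n)"
  define T where "T = table_start xs CARD('n)"
  let ?c = "xs ! k"
  note inv = J[unfolded output_inv_def Let_def, folded E_def, folded cs_def, folded S_def, folded T_def]
  have c: "?c \<in> set xs"
    using k by simp
  define s1 where "s1 = sem (centre_prog CARD('n)) s"
  have snd1: "snd s1 = snd s"
    by (simp add: s1_def sem_no_store centre_prog_simps)
  have regs1: "fst s1 r = fst s r" if "r \<notin> {2, 3, 4, 9, 12}" for r
    unfolding s1_def using that centre_prog_simps(3)[of "CARD('n)"] by (intro sem_frame) auto
  have b1: "base xs s1"
    unfolding s1_def using b centre_prog_simps(2) order_trans[OF centre_prog_simps(3)]
    by (intro base_no_store) auto
  have ctr: "0 < fst s1 9 \<longleftrightarrow> centre E ?c"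
    unfolding s1_def using b inv r5 c by (intro centre_prog_correct) auto
  have take: "filter (centre E) (take (Suc k) xs) = (if centre E ?c then cs @ [?c] else cs)"
    using k by (simp add: take_Suc_conv_app_nth cs_def)
  have "output_inv f xs (Suc k) (sem (output_prog f) s) \<and>
    (a < T \<longrightarrow> snd (sem (output_prog f) s) a = snd s a)" for a
  proof (cases "centre E ?c")
    case False
    then have "sem (output_prog f) s = sem skip s1"
      using ctr by (simp add: output_prog_def s1_def)
    then show ?thesis
      using inv False take
      by (simp add: output_inv_def regs1 snd1 flip: E_def S_def T_def)
  next
    case True
    let ?A = "dirs E ?c"
    obtain \<rho> where \<rho>: "\<And>r. r \<notin> {2, 3} \<Longrightarrow> \<rho> r = fst s1 r"
      and sem2: "sem (decide dir_list (write_record f) {}) s1 = sem (write_record f ?A) (\<rho>, snd s1)"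
      using sem_decide[OF b1, of E ?c dir_list "write_record f" "{}"] inv r5 c
      by (auto simp: snd1 regs1 set_dir_list)
    have regs: "\<rho> r = fst s r" if "r \<notin> {2, 3, 4, 9, 12}" for r
      using \<rho> regs1 that by simp
    define s3 where "s3 = sem (emit (record_entries f ?A)) (\<rho>, snd s)"
    have final: "sem (output_prog f) s = ((fst s3)(2 := 1, 11 := fst s3 11 + 1), snd s3)"
      using True ctr sem2 by (simp add: output_prog_def s1_def[symmetric] write_record_def s3_def snd1)
    let ?q = "T + int (length cs * S)"
    have q: "\<rho> 8 = ?q" "\<rho> 6 = int (k * CARD('n))" "\<rho> 11 = int (length cs)"
      using inv r6 by (simp_all add: regs)
    have len: "length (record_entries f ?A) = S"
      by (simp add: length_record_entries S_def)
    \<comment> \<open>The coordinates copied into the record lie in the input, hence below the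
      position of writing, as \<open>sem_emit\<close> requires.\<close>
    have lt: "\<rho> 6 + int j < ?q" if "Inr j \<in> set (record_entries f ?A)" for j
    proof -
      have "j < CARD('n)"
        using that by (auto simp: record_entries_def)
      then have "\<rho> 6 + int j < int (length xs * CARD('n))"
        using input_address[OF k, of "from_nat_into UNIV j"] by (simp add: q num_from_nat_into)
      also have "\<dots> \<le> T"
        unfolding T_def by (rule table_start_ge)
      also have "\<dots> \<le> ?q"
        by simp
      finally show ?thesis .
    qed
    have s3: "snd s3 = (\<lambda>a. if ?q \<le> a \<and> a < ?q + int S
          then entry (snd s) (\<rho> 6) (record_entries f ?A ! nat (a - ?q)) else snd s a)"
      "fst s3 8 = ?q + int S"
      using sem_emit[of "(\<rho>, snd s)" ?q "\<rho> 6" "record_entries f ?A", unfolded fst_conv snd_conv len,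
          OF q(1) refl lt]
      unfolding s3_def by blast+
    have "11 \<notin> writes (emit (record_entries f ?A))"
      using emit_simps(2)[of "record_entries f ?A"] by auto
    then have r11: "fst s3 11 = int (length cs)"
      unfolding s3_def by (simp add: sem_frame q)
    have below: "snd s3 a = snd s a" if "a < ?q" for a
      using that by (simp add: s3)
    have "0 \<le> ?q"
      by (simp add: T_def table_start_nonneg)
    have "encodes xs (snd s3) E"
    proof (rule encodes_cong)
      show "encodes xs (snd s) E"
        using inv by blast
      show "snd s3 a = snd s a" if "a < 0" for a
        using that \<open>0 \<le> ?q\<close> by (intro below) linarith
    qed
    moreover have "read_placement (snd s3) (T + int (m * S)) = placed f E ((cs @ [?c]) ! m)"
      if m: "m < length (cs @ [?c])" for m
    proof (cases "m < length cs")
      case True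
      have "read_placement (snd s3) (T + int (m * S)) = (read_placement (snd s) (T + int (m * S)) :: 'n placement)"
      proof (rule read_placement_cong)
        fix l assume "l < record_size TYPE('n)"
        then have "m * S + l < Suc m * S"
          by (simp add: S_def)
        also have "\<dots> \<le> length cs * S"
          using True by (intro mult_le_mono1) simp
        finally have "m * S + l < length cs * S" .
        then have "T + int (m * S) + int l < ?q"
          by linarith
        then show "snd s3 (T + int (m * S) + int l) = snd s (T + int (m * S) + int l)"
          by (rule below)
      qed
      then show ?thesis
        using inv True by (simp add: nth_append)
    next
      case False
      then have m: "m = length cs"
        using m by simp
      have "read_placement (snd s3) ?q = (int (fst (f ?A)), snd (f ?A), ?c)"
      proof (rule read_record)
        show "snd s3 (?q + int l) = entry (snd s) (\<rho> 6) (record_entries f ?A ! l)"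
          if "l < record_size TYPE('n)" for l
          using that by (simp add: s3 S_def)
        show "snd s (\<rho> 6 + int (num i)) = ?c $ i" for i
          using b k unfolding base_def input_cells_def q(2) by blast
      qed
      then show ?thesis
        by (simp add: m placed_def)
    qed
    ultimately have "output_inv f xs (Suc k) (sem (output_prog f) s)"
      unfolding output_inv_def Let_def E_def[symmetric] take S_def[symmetric] T_def[symmetric] final
      using True r11 s3(2) by (simp add: algebra_simps)
    moreover have "a < T \<longrightarrow> snd (sem (output_prog f) s) a = snd s a"
    proof
      assume "a < T"
      moreover have "T \<le> ?q"
        by simp
      ultimately have "a < ?q"
        by (rule less_le_trans)
      then show "snd (sem (output_prog f) s) a = snd s a"
        unfolding final by (simp add: below)
    qed
    ultimately show ?thesis ..
  qed
  then show "output_inv f xs (Suc k) (sem (output_prog f) s)"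
    and "a < table_start xs CARD('n) \<Longrightarrow> snd (sem (output_prog f) s) a = snd s a"
    unfolding T_def by blast+
qed

lemma lin_output:
  fixes f :: "('n::finite) choice"
  shows "lin length (\<lambda>xs s. base xs s \<and> output_inv f xs 0 s) (scan CARD('n) (output_prog f))
    (\<lambda>xs s. base xs s \<and> output_inv f xs (length xs) s)"
proof (rule lin_scan)
  show "loop_free (output_prog f)"
    by (simp add: output_prog_def centre_prog_simps loop_free_decide write_record_def emit_simps)
  show "writes (output_prog f) \<subseteq> {2..<20} - {6, 7}"
    by (rule order_trans[OF output_prog_writes]) auto
  show "output_inv f xs k (\<rho>, snd s)"
    if "output_inv f xs k s" "\<And>r. r \<notin> {2, 3, 5, 6, 7} \<Longrightarrow> \<rho> r = fst s r" for xs k s \<rho>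
    using that by (simp add: output_inv_def)
qed (use output_prog_step in auto)

section \<open>The complete algorithm and its correctness\<close>

definition tiling_prog :: "('n::finite) choice \<Rightarrow> ram_prog" where
  "tiling_prog f = Seq (setup_prog CARD('n)) (Seq (scan CARD('n) mark_prog)
     (Seq (scan CARD('n) (link_prog CARD('n))) (Seq (scan CARD('n) (prune_prog CARD('n)))
     (Seq (seqs [Const 2 0, Add 8 1 2, Const 11 0]) (Seq (scan CARD('n) (output_prog f))
     (seqs [Const 2 0, Add 0 11 2]))))))"

lemma lin_tiling_prog:
  fixes f :: "('n::finite) choice"
  shows "lin length (\<lambda>xs s. proper_input xs \<and> s = input_state xs) (tiling_prog f)
    (\<lambda>xs s. output_placements s =
       map (placed f (pruned xs (length xs))) (filter (centre (pruned xs (length xs))) xs))"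
  unfolding tiling_prog_def
proof (rule lin_Seq[OF lin_setup_prog], rule lin_Seq[OF lin_mark], rule lin_Seq[OF lin_link],
    rule lin_Seq[OF lin_prune], rule lin_Seq[OF _ lin_Seq[OF lin_output]])
  show "lin length (\<lambda>(xs :: (int ^ 'n) list) s. base xs s \<and> encodes xs (snd s) (pruned xs (length xs)))
      (seqs [Const 2 0, Add 8 1 2, Const 11 0]) (\<lambda>xs s. base xs s \<and> output_inv f xs 0 s)"
  proof (rule lin_loop_free)
    fix xs :: "(int ^ 'n) list" and s
    let ?s = "sem (seqs [Const 2 0, Add 8 1 2, Const 11 0]) s"
    assume A: "base xs s \<and> encodes xs (snd s) (pruned xs (length xs))"
    have "base xs ?s"
      by (rule base_cong[OF conjunct1[OF A]]) auto
    moreover have "output_inv f xs 0 ?s"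
      using A by (simp add: output_inv_def base_def)
    moreover have "0 < length xs"
      using A proper_input_nonempty[of xs] by (simp add: base_def)
    ultimately show "0 < length xs \<and> base xs ?s \<and> output_inv f xs 0 ?s"
      by blast
  qed simp
  show "lin length (\<lambda>xs s. base xs s \<and> output_inv f xs (length xs) s) (seqs [Const 2 0, Add 0 11 2])
    (\<lambda>xs s. output_placements s =
       map (placed f (pruned xs (length xs))) (filter (centre (pruned xs (length xs))) xs))"
  proof (rule lin_loop_free)
    fix xs :: "(int ^ 'n) list" and s
    let ?s = "sem (seqs [Const 2 0, Add 0 11 2]) s"
    assume A: "base xs s \<and> output_inv f xs (length xs) s"
    let ?E = "pruned xs (length xs)"
    let ?cs = "filter (centre ?E) xs"
    have inv: "fst s 11 = int (length ?cs)" "\<And>m. m < length ?cs \<Longrightarrow>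
        read_placement (snd s) (table_start xs CARD('n) + int (m * record_size TYPE('n))) = placed f ?E (?cs ! m)"
      using A by (simp_all add: output_inv_def Let_def)
    have "fst ?s 0 = int (length ?cs)" "fst ?s 1 = table_start xs CARD('n)" "snd ?s = snd s"
      using A inv(1) by (simp_all add: base_def)
    then have "output_placements ?s = map (\<lambda>m. placed f ?E (?cs ! m)) [0..<length ?cs]"
      unfolding output_placements_def using inv(2) by (simp add: record_size_def)
    also have "\<dots> = map (placed f ?E) ?cs"
      by (rule nth_equalityI) simp_all
    finally show "0 < length xs \<and> output_placements ?s = map (placed f ?E) ?cs"
      using A proper_input_nonempty[of xs] by (simp add: base_def)
  qed simp
qed

text \<open>The chosen rotation carries the tile to a star around the origin, so the translation
  vector is the centre itself. This is why a record can copy the coordinates of the current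
  cube.\<close>

lemma describes_tiling_placed:
  fixes xs :: "(int ^ 'n::finite) list" and f :: "'n choice"
  assumes xs: "proper_input xs"
    and f: "\<And>A. A \<noteq> {} \<Longrightarrow> fst (f A) < length ts \<and> rotation_matrix (snd (f A)) \<and>
      (*v) (snd (f A)) ` (ts ! fst (f A)) = star A"
  shows "describes_tiling ts (set xs)
    (map (placed f (pruned xs (length xs))) (filter (centre (pruned xs (length xs))) xs))"
proof -
  define E where "E = pruned xs (length xs)"
  define cs where "cs = filter (centre E) xs"
  have "adjacencies (set xs) \<subseteq> set (edge_list xs)"
    by (auto simp: edge_list_def adjacencies_def set_axes)
  then interpret star_graph E "set xs"
    using xs star_graph_fold_prune[of "set xs" "edge_list xs"]
    by (simp add: E_def pruned_def proper_input_def)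
  have set_cs: "set cs = {c \<in> set xs. centre E c}"
    by (auto simp: cs_def)
  have ne: "dirs E c \<noteq> {}" if "c \<in> set cs" for c
    using covering that by (simp add: cs_def)
  have tile: "placed_tile ts (placed f E c) = cell E c" if "c \<in> set cs" for c
  proof -
    have "placed_tile ts (placed f E c) = (\<lambda>x. x + c) ` (*v) (snd (f (dirs E c))) ` (ts ! fst (f (dirs E c)))"
      by (simp add: placed_tile_def placed_def place_def image_image)
    then show ?thesis
      using f[OF ne[OF that]] by (simp add: cell_def)
  qed
  have "map (placed_tile ts) (map (placed f E) cs) = map (cell E) cs"
    using tile by simp
  moreover have "inj_on (cell E) (set cs)"
    using inj_on_cell by (rule inj_on_subset) (auto simp: cs_def)
  then have "distinct (map (cell E) cs)"
    using xs by (simp add: distinct_map cs_def proper_input_def)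
  moreover have cells: "placed_tile ts ` set (map (placed f E) cs) = cell E ` set cs"
    using tile by (simp add: image_image)
  moreover have "\<exists>T\<in>set ts. is_copy T P" if P: "P \<in> cell E ` set cs" for P
  proof -
    obtain c where c: "c \<in> set cs" "P = cell E c"
      using P by blast
    have "is_copy (ts ! fst (f (dirs E c))) P"
      unfolding is_copy_def c(2) tile[OF c(1), symmetric] using f[OF ne[OF c(1)]]
      by (intro exI[of _ "snd (f (dirs E c))"] exI[of _ c]) (simp add: placed_tile_def placed_def)
    then show ?thesis
      using f[OF ne[OF c(1)]] by (meson nth_mem)
  qed
  moreover have "partition_on (set xs) (cell E ` set cs)"
    unfolding set_cs by (rule partition_cells)
  moreover have "valid_placement ts p" if "p \<in> set (map (placed f E) cs)" for p
    using that f[OF ne] by (auto simp: valid_placement_def placed_def)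
  ultimately show ?thesis
    unfolding describes_tiling_def is_tiling_def E_def[symmetric] cs_def[symmetric] by metis
qed

theorem theorem1p2:
  assumes "CARD('n::finite) \<ge> 2"
  shows "\<exists>S :: (int ^ 'n) set set.
    tile_set S \<and>
    card S = CARD('n) * (CARD('n) + 3) div 2 \<and>
    (\<forall>R. polyomino R \<longrightarrow> \<not> is_singleton R \<longrightarrow> tiles_polyomino S R) \<and>
    (\<exists>prog. linear_time_tiling_algorithm S prog)"
proof -
  define S where "S = (\<lambda>t. star (arms t) :: (int ^ 'n) set) ` star_types TYPE('n)"
  have "finite S"
    by (simp add: S_def)
  then obtain ts where ts: "set ts = S" "distinct ts"
    using finite_distinct_list by blast
  \<comment> \<open>The choice is made once, before any polyomino is given, so the program depends
    on the tiles only. The empty set gets an arbitrary value; it does not occur, as no cube is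
    isolated after pruning.\<close>
  have "\<exists>p :: nat \<times> (int ^ 'n ^ 'n). A \<noteq> {} \<longrightarrow> fst p < length ts \<and> rotation_matrix (snd p) \<and>
      (*v) (snd p) ` (ts ! fst p) = star A" for A :: "('n \<times> bool) set"
  proof (cases "A = {}")
    case False
    then obtain t and Q :: "int ^ 'n ^ 'n" where t: "t \<in> star_types TYPE('n)" "rotation_matrix Q"
      "(*v) Q ` star (arms t) = star A"
      using ex_star_rotation[OF assms] by blast
    then have "star (arms t) \<in> set ts"
      by (auto simp: ts S_def)
    then obtain k where "k < length ts" "ts ! k = star (arms t)"
      by (auto simp: in_set_conv_nth)
    then show ?thesis
      using t by (intro exI[of _ "(k, Q)"]) simp
  qed simp
  then obtain f :: "'n choice" where f: "\<And>A. A \<noteq> {} \<Longrightarrow> fst (f A) < length ts \<and>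
      rotation_matrix (snd (f A)) \<and> (*v) (snd (f A)) ` (ts ! fst (f A)) = star A"
    by metis
  obtain C where C: "\<And>xs s. proper_input xs \<and> s = input_state xs \<Longrightarrow> \<exists>t\<le>C * length xs. \<exists>s'.
      exec (tiling_prog f) s t s' \<and> output_placements s' =
        map (placed f (pruned xs (length xs))) (filter (centre (pruned xs (length xs))) xs)"
    using lin_tiling_prog[of f] unfolding lin_def by blast
  have run: "\<exists>t s. exec (tiling_prog f) (input_state xs) t s \<and> t \<le> C * card R \<and>
      describes_tiling ts R (output_placements s)"
    if R: "polyomino R" "\<not> is_singleton R" "distinct xs" "set xs = R" for R xs
  proof -
    have xs: "proper_input xs"
      using R by (simp add: proper_input_def)
    obtain t s where "t \<le> C * length xs" "exec (tiling_prog f) (input_state xs) t s"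
      "output_placements s =
        map (placed f (pruned xs (length xs))) (filter (centre (pruned xs (length xs))) xs)"
      using C[of xs "input_state xs"] xs by blast
    moreover have "card R = length xs"
      using R distinct_card by blast
    ultimately show ?thesis
      using describes_tiling_placed[OF xs f] R(4) by (intro exI[of _ t] exI[of _ s]) simp
  qed
  \<comment> \<open>Existence of a tiling is read off from a run of the algorithm on any enumeration
    of the cubes.\<close>
  have "tiles_polyomino S R" if R: "polyomino R" "\<not> is_singleton R" for R
  proof -
    have "finite R"
      using R(1) by (simp add: polyomino_def)
    then obtain xs where xs: "set xs = R" "distinct xs"
      using finite_distinct_list by blast
    show ?thesis
      using run[OF R xs(2,1)] ts(1) unfolding describes_tiling_def tiles_polyomino_def by blast
  qed
  moreover have "linear_time_tiling_algorithm S (tiling_prog f)"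
    unfolding linear_time_tiling_algorithm_def using ts run by blast
  moreover have "tile_set S"
    unfolding S_def by (rule tile_set_stars)
  moreover have "card S = CARD('n) * (CARD('n) + 3) div 2"
    unfolding S_def by (simp add: card_image inj_on_star_arms card_star_types)
  ultimately show ?thesis
    by blast
qed

end
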